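(* Let $N\ge2$ and let $(X,d,\mathfrak m)$ be a Polish metric measure space. Assume that $\rho\mathfrak m\in\mathcal P^{ac}(X)$ satisfies $\rho\log\rho\in L^1_{\mathfrak m}(X)$ along with conditions (A) and (B) (see context). Assume that the cost $c:X^N\to\mathbb R\cup\{+\infty\}$, $c(x_1,\dots,x_N)=\sum_{1\le i<j\le N}f(d(x_i,x_j))$, satisfies conditions (F1) and (F2) (see context). Then, for each $\varepsilon\ge0$, there exists a minimizer $\gamma\in\Pi^{\mathrm{sym}}_N(\rho)$ of the entropy-regularized cost $C_\varepsilon$ over $\Pi_N^{\mathrm{sym}}(\rho)$.
   Context: $(X,d)$ is a complete separable metric space equipped with a ($\sigma$-finite, nonnegative) Borel reference measure $\mathfrak m$; $\mathfrak m_N=\mathfrak m\otimes\cdots\otimes\mathfrak m$ is the product measure on $X^N$. $\mathcal P^{ac}(X)$ is the set of Borel probability measures on $X$ absolutely continuous with respect to $\mathfrak m$; $\rho\mathfrak m$ is the measure with density $\rho$, also denoted $\rho$ by abuse of notation. $\Pi^{\mathrm{sym}}_N(\rho)$ is the set of Borel probability measures on $X^N$ that are invariant under all permutations of the $N$ coordinates and all of whose one-coordinate marginals equal $\rho\mathfrak m$. The function $f:[0,\infty)\to\mathbb R\cup\{+\infty\}$, with $f(0)=+\infty$, satisfies: (F1) $f|_{(0,\infty)}$ is real-valued, continuous and decreasing; (F2) $\lim_{t\to0+}f(t)=+\infty$. Conditions on $\rho$: (A) $\lim_{r\to0}\sup_{x\in X}\rho(B(x,r))<\frac1{N(N-1)^2}$;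 (B) $\int_{X\setminus B(o,r_0)}f(2d(x,o))\,\mathrm d\rho(x)>-\infty$ for some $o\in X$ and some $r_0>0$. Here $B(x,r)$ is the ball of radius $r$ around $x$. $C_\varepsilon[\gamma]=C_0[\gamma]+\varepsilon E[\gamma]$ for $\varepsilon>0$, where $C_0[\gamma]=\int_{X^N}c\,\mathrm d\gamma$ (for $\varepsilon=0$ the functional is $C_0$ itself), and $E[\gamma]=\int_{X^N}\rho_\gamma\log\rho_\gamma\,\mathrm d\mathfrak m_N$ if $\gamma\ll\mathfrak m_N$ with density $\rho_\gamma=\frac{\mathrm d\gamma}{\mathrm d\mathfrak m_N}$, and $E[\gamma]=+\infty$ otherwise. *)

theory Defs
  imports "HOL-Probability.Probability"
begin

text \<open>
  The Lebesgue integral with values in the extended reals: the integral of the positive part minus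
  that of the negative part. Since \<^term>\<open>e2ennreal\<close> sends negative arguments to 0, its composition
  with \<^term>\<open>g\<close> and with \<^term>\<open>\<lambda>x. - g x\<close> gives the two parts. The value is meaningful whenever at
  least one of the two integrals is finite; otherwise it is \<open>\<infinity> - \<infinity> = \<infinity>\<close> by the library's
  convention for \<^typ>\<open>ereal\<close>.
\<close>

definition ext_integral :: "'b measure \<Rightarrow> ('b \<Rightarrow> ereal) \<Rightarrow> ereal" where
  "ext_integral M g =
     enn2ereal (\<integral>\<^sup>+ x. e2ennreal (g x) \<partial>M) - enn2ereal (\<integral>\<^sup>+ x. e2ennreal (- g x) \<partial>M)"

definition Pac :: "'a::polish_space measure \<Rightarrow> 'a measure set" where
  "Pac m = {\<mu>. sets \<mu> = sets borel \<and> prob_space \<mu> \<and> absolutely_continuous m \<mu>}"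

text \<open>
  Points of \<open>X\<^sup>N\<close> are functions on the index set \<open>{..<N}\<close>, extended by \<^term>\<open>undefined\<close>. As the
  space is second countable, the product sigma-algebra is the Borel sigma-algebra of \<open>X\<^sup>N\<close>.
\<close>

abbreviation borel_N :: "nat \<Rightarrow> (nat \<Rightarrow> 'a::polish_space) measure" where
  "borel_N N \<equiv> PiM {..<N} (\<lambda>_. borel)"

abbreviation prod_N :: "nat \<Rightarrow> 'a::polish_space measure \<Rightarrow> (nat \<Rightarrow> 'a) measure" where
  "prod_N N m \<equiv> PiM {..<N} (\<lambda>_. m)"

definition Pi_sym :: "nat \<Rightarrow> 'a::polish_space measure \<Rightarrow> (nat \<Rightarrow> 'a) measure set" where
  "Pi_sym N \<mu> = {\<gamma>. sets \<gamma> = sets (borel_N N) \<and> prob_space \<gamma> \<and>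
     (\<forall>\<pi>. \<pi> permutes {..<N} \<longrightarrow>
        distr \<gamma> (borel_N N) (\<lambda>x. restrict (\<lambda>i. x (\<pi> i)) {..<N}) = \<gamma>) \<and>
     (\<forall>i<N. distr \<gamma> borel (\<lambda>x. x i) = \<mu>)}"

text \<open>
  The function \<open>f : [0,\<infinity>) \<rightarrow> \<real> \<union> {+\<infinity>}\<close> is a function \<^typ>\<open>real \<Rightarrow> ereal\<close> of which only the values at
  nonnegative arguments matter. ``Decreasing'' is meant in the weak sense.
\<close>

definition cond_F1 :: "(real \<Rightarrow> ereal) \<Rightarrow> bool" where
  "cond_F1 f \<longleftrightarrow> (\<forall>t>0. \<bar>f t\<bar> \<noteq> \<infinity>) \<and> continuous_on {0<..} f \<and> antimono_on {0<..} f"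

definition cond_F2 :: "(real \<Rightarrow> ereal) \<Rightarrow> bool" where
  "cond_F2 f \<longleftrightarrow> (f \<longlongrightarrow> \<infinity>) (at_right 0)"

text \<open>
  The supremum in \<open>cond_A\<close> is monotone in \<open>r\<close> and bounded below by 0, so the limit always exists
  when \<^term>\<open>\<mu>\<close> is a probability measure.
\<close>

definition cond_A :: "nat \<Rightarrow> 'a::polish_space measure \<Rightarrow> bool" where
  "cond_A N \<mu> \<longleftrightarrow>
     (\<exists>L. ((\<lambda>r. SUP x. measure \<mu> (ball x r)) \<longlongrightarrow> L) (at_right 0) \<and>
          L < 1 / (real N * (real N - 1)\<^sup>2))"

definition cond_B :: "(real \<Rightarrow> ereal) \<Rightarrow> 'a::polish_space measure \<Rightarrow> bool" where
  "cond_B f \<mu> \<longleftrightarrow>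
     (\<exists>z r0. r0 > 0 \<and>
        ext_integral \<mu> (\<lambda>x. indicator (- ball z r0) x * f (2 * dist x z)) > -\<infinity>)"

definition cost :: "nat \<Rightarrow> (real \<Rightarrow> ereal) \<Rightarrow> (nat \<Rightarrow> 'a::polish_space) \<Rightarrow> ereal" where
  "cost N f x = (\<Sum>i<N. \<Sum>j\<in>{i<..<N}. f (dist (x i) (x j)))"

definition C0 :: "nat \<Rightarrow> (real \<Rightarrow> ereal) \<Rightarrow> (nat \<Rightarrow> 'a::polish_space) measure \<Rightarrow> ereal" where
  "C0 N f \<gamma> = ext_integral \<gamma> (cost N f)"

definition Ent :: "nat \<Rightarrow> 'a::polish_space measure \<Rightarrow> (nat \<Rightarrow> 'a) measure \<Rightarrow> ereal" where
  "Ent N m \<gamma> =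
     (if absolutely_continuous (prod_N N m) \<gamma>
      then ext_integral (prod_N N m)
             (\<lambda>x. let r = enn2real (RN_deriv (prod_N N m) \<gamma> x) in ereal (r * ln r))
      else \<infinity>)"

definition C_eps ::
    "nat \<Rightarrow> 'a::polish_space measure \<Rightarrow> (real \<Rightarrow> ereal) \<Rightarrow> real \<Rightarrow> (nat \<Rightarrow> 'a) measure \<Rightarrow> ereal" where
  "C_eps N m f \<epsilon> \<gamma> = (if \<epsilon> = 0 then C0 N f \<gamma> else C0 N f \<gamma> + ereal \<epsilon> * Ent N m \<gamma>)"

end

theory Submission
  imports Defs
begin

text \<open>
  Direct method. Couplings with fixed marginals are compact for convergence on finite
  intersections of sets \<open>{x. x i \<in> U k}\<close>, where \<open>U\<close> is a countable base of \<open>X\<close>: record the countably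
  many membership bits of a point of \<open>X\<^sup>N\<close> as ternary digits of one real number, apply Helly's
  selection theorem on the line, and decode. No tightness is needed, since the fixed marginals force
  the limiting bits to be bits of actual points almost surely.

  By inclusion--exclusion this convergence gives \<open>\<gamma> V \<le> liminf (\<gamma>\<^sub>n V)\<close> for open \<open>V\<close>, so the transport cost,
  made nonnegative by adding integrable functions of single coordinates, is lower semicontinuous by
  the layer cake formula and Fatou. On the couplings the entropy is, up to a constant, the entropy
  relative to the product of the marginals. A bound on the latter makes the densities uniformly
  integrable; convergence then holds on all measurable sets, and tangent lines of \<open>t ln t\<close> give lower
  semicontinuity.
\<close>

section \<open>Limits of countably many events\<close>

text \<open>Both constants split off from the functional depend only on the marginal: condition (B)
  makes \<open>tail z\<close> integrable, and integrability of \<rho> log \<rho> makes its N-fold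
  integral finite. On the couplings \<open>C_eps\<close> is therefore a functional \<open>J\<close>
  with values in [0, infinity] plus one real number, and infinity - infinity never arises.
  Boundaries of base sets may carry mass, so weak convergence alone would not control the measure of
  boxes. Fixed marginals repair this: the bits of each single coordinate have the same law along the
  whole sequence, and the limit inherits exactly that law. The digits are ternary because the
  middle-third gaps let a continuous function read a bit. For the entropy, the natural point of
  tangency is the limiting density, whose logarithm may be unbounded. It is replaced by its
  truncation to [1/(k+1), k+1], and k tends to infinity only after n. Symmetry survives the limit
  because permuting coordinates maps boxes to boxes.\<close>

text \<open>
  On a series \<open>\<Sum>k. 2 b\<^sub>k / 3\<^bsup>k+1\<^esup>\<close> with bits \<open>b\<^sub>k\<close>, the shift \<open>t \<mapsto> 3 t - 2 b\<^sub>0\<close> drops the first bit. Unlike a true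
  ternary digit, \<open>digit k\<close> is continuous on the whole line.
\<close>

definition ternary :: "(nat \<Rightarrow> bool) \<Rightarrow> real" where
  "ternary b = (\<Sum>k. 2 * of_bool (b k) / 3 ^ Suc k)"

definition lead_digit :: "real \<Rightarrow> real" where
  "lead_digit t = max 0 (min 1 (3 * t - 1))"

definition digit_shift :: "real \<Rightarrow> real" where
  "digit_shift t = 3 * t - 2 * lead_digit t"

definition digit :: "nat \<Rightarrow> real \<Rightarrow> real" where
  "digit k t = lead_digit ((digit_shift ^^ k) t)"

lemma ternary_summable: "summable (\<lambda>k. 2 * of_bool (b k) / 3 ^ Suc k :: real)"
proof (rule summable_comparison_test')
  show "summable (\<lambda>k. 2 * (1 / 3) ^ k :: real)"
    by (intro summable_mult summable_geometric) simp
  show "norm (2 * of_bool (b k) / 3 ^ Suc k :: real) \<le> 2 * (1 / 3) ^ k" for k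
    by (simp add: field_simps)
qed

lemma ternary_nonneg: "0 \<le> ternary b"
  unfolding ternary_def by (intro suminf_nonneg ternary_summable) auto

lemma ternary_le_1: "ternary b \<le> 1"
proof -
  have g: "(\<lambda>k. 2 / 3 * (1 / 3) ^ k :: real) sums (2 / 3 * (1 / (1 - 1 / 3)))"
    by (intro sums_mult geometric_sums) simp
  have "ternary b \<le> (\<Sum>k. 2 / 3 * (1 / 3) ^ k)"
    unfolding ternary_def
    by (intro suminf_le ternary_summable sums_summable[OF g]) (simp add: field_simps)
  also have "\<dots> = 1"
    using g by (simp add: sums_iff)
  finally show ?thesis .
qed

lemma ternary_Suc: "ternary b = 2 / 3 * of_bool (b 0) + ternary (b \<circ> Suc) / 3"
proof -
  have "ternary b = 2 / 3 * of_bool (b 0) + (\<Sum>k. 2 * of_bool (b (Suc k)) / 3 ^ Suc (Suc k))"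
    unfolding ternary_def
    using suminf_split_head[OF ternary_summable[of b]] by simp
  also have "(\<Sum>k. 2 * of_bool (b (Suc k)) / 3 ^ Suc (Suc k)) =
             (\<Sum>k. (1 / 3) * (2 * of_bool ((b \<circ> Suc) k) / 3 ^ Suc k) :: real)"
    by (intro suminf_cong) simp
  also have "\<dots> = (1 / 3) * ternary (b \<circ> Suc)"
    unfolding ternary_def by (rule suminf_mult[OF ternary_summable])
  finally show ?thesis by simp
qed

text \<open>The remaining digits contribute between 0 and 1/3, so a code lies in [0, 1/3] or in
  [2/3, 1] according to its first bit. The ramp \<open>lead_digit\<close> rises only across the gap
  in between.\<close>

lemma lead_digit_ternary: "lead_digit (ternary b) = of_bool (b 0)"
proof -
  have "lead_digit (2 / 3 * of_bool c + u / 3) = of_bool c" if "0 \<le> u" "u \<le> 1" for c u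
    using that by (cases c) (auto simp: lead_digit_def)
  from this[OF ternary_nonneg ternary_le_1] show ?thesis
    unfolding ternary_Suc[of b] .
qed

lemma digit_ternary: "digit k (ternary b) = of_bool (b k)"
proof -
  have "digit_shift (ternary b) = ternary (b \<circ> Suc)" for b
    unfolding digit_shift_def lead_digit_ternary using ternary_Suc[of b] by linarith
  then have "(digit_shift ^^ k) (ternary b) = ternary (\<lambda>j. b (j + k))"
    by (induction k arbitrary: b) (simp_all add: o_def funpow_swap1)
  then show ?thesis
    by (simp add: digit_def lead_digit_ternary)
qed

lemma continuous_digit: "continuous_on UNIV (digit k)"
proof -
  have 0: "continuous_on A lead_digit" for A
    unfolding lead_digit_def by (intro continuous_intros)
  have s: "continuous_on UNIV digit_shift"
    unfolding digit_shift_def by (intro continuous_intros 0)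
  have "continuous_on UNIV (digit_shift ^^ k)"
  proof (induction k)
    case (Suc k)
    then show ?case
      using continuous_on_compose[OF Suc continuous_on_subset[OF s]] by simp
  qed (simp add: id_def)
  then show ?thesis
    unfolding digit_def[abs_def]
    using continuous_on_compose[OF _ 0, of UNIV "digit_shift ^^ k"] by (simp add: o_def)
qed

lemma digit_bounds: "0 \<le> digit k t" "digit k t \<le> 1"
  by (auto simp: digit_def lead_digit_def)

lemma digit_measurable [measurable]: "digit k \<in> borel_measurable borel"
  by (intro borel_measurable_continuous_onI continuous_digit)

text \<open>Pushed forward by the code of all bits, the measures become laws on [0, 1], and a weak
  limit can be tested against continuous functions of the digits. The limit is only a law on the
  line, since at this stage a limiting bit pattern need not come from a point of
  \<open>space K\<close>.\<close>

lemma bits_subsequence_nat: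
  fixes \<gamma> :: "nat \<Rightarrow> 'b measure" and B :: "nat \<Rightarrow> 'b set"
  assumes prob: "\<And>n. prob_space (\<gamma> n)" and sets: "\<And>n. sets (\<gamma> n) = sets K"
    and B: "\<And>k. B k \<in> sets K"
  obtains r M where "strict_mono r" "real_distribution M"
    "\<And>J. finite J \<Longrightarrow>
       (\<lambda>n. measure (\<gamma> (r n)) {x \<in> space K. \<forall>k\<in>J. x \<in> B k}) \<longlonglongrightarrow>
       measure M {t. \<forall>k\<in>J. digit k t = 1}"
proof -
  have sp: "space (\<gamma> n) = space K" for n
    using sets by (rule sets_eq_imp_space_eq)
  define \<tau> where "\<tau> x = ternary (\<lambda>k. x \<in> B k)" for x
  have \<tau>K: "\<tau> \<in> borel_measurable K"
    unfolding \<tau>_def[abs_def] ternary_def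
  proof (rule borel_measurable_suminf)
    fix k show "(\<lambda>x. 2 * of_bool (x \<in> B k) / 3 ^ Suc k :: real) \<in> borel_measurable K"
      using B[of k] by (auto simp: of_bool_def intro!: borel_measurable_divide borel_measurable_times measurable_If_set)
  qed
  then have \<tau>: "\<tau> \<in> borel_measurable (\<gamma> n)" for n
    using measurable_cong_sets[OF sets refl] by blast
  define D where "D n = distr (\<gamma> n) borel \<tau>" for n
  have D: "real_distribution (D n)" for n
    unfolding D_def by (rule prob_space.real_distribution_distr[OF prob \<tau>])
  have "tight D"
    unfolding tight_def
  proof (intro conjI allI impI D)
    fix e :: real assume "0 < e"
    \<comment> \<open>Tightness is phrased with left-open intervals, and 0 is the code of the
      all-false sequence; hence the left end -1.\<close>
    have "measure (D n) {-1<..1} > 1 - e" for n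
    proof -
      interpret prob_space "\<gamma> n" by (rule prob)
      have "\<tau> -` {-1<..1} \<inter> space (\<gamma> n) = space (\<gamma> n)"
        using ternary_le_1 by (auto simp: \<tau>_def intro!: less_le_trans[OF _ ternary_nonneg])
      then have "measure (D n) {-1<..1} = 1"
        unfolding D_def by (simp add: measure_distr[OF \<tau>] prob_space)
      with \<open>0 < e\<close> show ?thesis by simp
    qed
    then show "\<exists>a b. a < b \<and> (\<forall>n. 1 - e < measure (D n) {a<..b})"
      by (intro exI[of _ "-1"] exI[of _ 1]) simp
  qed
  then obtain r M where r: "strict_mono r" and M: "real_distribution M"
    and conv: "weak_conv_m (D \<circ> id \<circ> r) M"
    using tight_imp_convergent_subsubsequence[of D id] by (auto simp: strict_mono_def)
  interpret M: real_distribution M by (rule M)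
  have int: "(\<lambda>n. \<integral>x. F (\<tau> x) \<partial>\<gamma> (r n)) \<longlonglongrightarrow> (\<integral>t. F t \<partial>M)"
    if F: "continuous_on UNIV F" and Fb: "\<And>t. norm (F t) \<le> 1" for F :: "real \<Rightarrow> real"
  proof -
    have "(\<lambda>n. \<integral>t. F t \<partial>D (r n)) \<longlonglongrightarrow> (\<integral>t. F t \<partial>M)"
      using weak_conv_imp_integral_bdd_continuous_conv[of "D \<circ> id \<circ> r" M F 1] D M conv F Fb
      by (auto simp: continuous_on_eq_continuous_at)
    moreover have "(\<integral>t. F t \<partial>D (r n)) = (\<integral>x. F (\<tau> x) \<partial>\<gamma> (r n))" for n
      unfolding D_def using F
      by (intro integral_distr \<tau>) (simp add: borel_measurable_continuous_onI)
    ultimately show ?thesis by simp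
  qed
  \<comment> \<open>A digit may lie strictly between 0 and 1 at a real number that is not a code.
    The test function d (1 - d) vanishes at every code, so its integral against the limit is
    zero.\<close>
  have bit: "AE t in M. digit k t = 0 \<or> digit k t = 1" for k
  proof -
    let ?F = "\<lambda>t. digit k t * (1 - digit k t)"
    have b: "0 \<le> ?F t" "?F t \<le> 1" for t
      using digit_bounds[of k t] by (auto intro: mult_le_one)
    have "(\<lambda>n. \<integral>x. ?F (\<tau> x) \<partial>\<gamma> (r n)) \<longlonglongrightarrow> (\<integral>t. ?F t \<partial>M)"
      using b by (intro int continuous_intros continuous_digit) (simp add: abs_le_iff)
    moreover have "?F (\<tau> x) = 0" for x
      by (simp add: \<tau>_def digit_ternary)
    ultimately have "(\<integral>t. ?F t \<partial>M) = 0"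
      by (simp add: LIMSEQ_const_iff)
    moreover have "integrable M ?F"
      using b by (intro M.integrable_const_bound[where B=1]) (auto simp: abs_le_iff)
    ultimately have "AE t in M. ?F t = 0"
      using b by (subst (asm) integral_nonneg_eq_0_iff_AE) auto
    then show ?thesis by eventually_elim auto
  qed
  have "(\<lambda>n. measure (\<gamma> (r n)) {x \<in> space K. \<forall>k\<in>J. x \<in> B k}) \<longlonglongrightarrow>
       measure M {t. \<forall>k\<in>J. digit k t = 1}" if J: "finite J" for J
  proof -
    \<comment> \<open>As the digits are almost surely 0 or 1 under \<open>M\<close>, this continuous
      product is there the indicator of the conjunction of bits.\<close>
    let ?F = "\<lambda>t. \<Prod>k\<in>J. digit k t"
    have b: "0 \<le> ?F t" "?F t \<le> 1" for t
      using digit_bounds by (auto intro!: prod_nonneg prod_le_1)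
    have "(\<lambda>n. \<integral>x. ?F (\<tau> x) \<partial>\<gamma> (r n)) \<longlonglongrightarrow> (\<integral>t. ?F t \<partial>M)"
      using b by (intro int continuous_on_prod continuous_digit) (simp add: abs_le_iff)
    moreover have "(\<integral>x. ?F (\<tau> x) \<partial>\<gamma> (r n)) = measure (\<gamma> (r n)) {x \<in> space K. \<forall>k\<in>J. x \<in> B k}" for n
    proof -
      have "(\<integral>x. ?F (\<tau> x) \<partial>\<gamma> (r n)) =
            (\<integral>x. indicator {x \<in> space K. \<forall>k\<in>J. x \<in> B k} x \<partial>\<gamma> (r n))"
        using J by (intro Bochner_Integration.integral_cong refl)
          (auto simp: \<tau>_def digit_ternary sp indicator_def)
      then show ?thesis
        by (simp add: sp Int_absorb2 Collect_restrict)
    qed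
    moreover have "(\<integral>t. ?F t \<partial>M) = measure M {t. \<forall>k\<in>J. digit k t = 1}"
    proof -
      have "AE t in M. \<forall>k\<in>J. digit k t = 0 \<or> digit k t = 1"
        using J bit by (simp add: AE_finite_all)
      then have "(\<integral>t. ?F t \<partial>M) = (\<integral>t. indicator {t. \<forall>k\<in>J. digit k t = 1} t \<partial>M)"
        using J
      proof (intro integral_cong_AE)
        have "{t. \<forall>k\<in>J. digit k t = 1} \<in> sets borel"
          using J by measurable
        then show "indicator {t. \<forall>k\<in>J. digit k t = 1} \<in> borel_measurable M"
          by simp
      qed (auto simp: indicator_def)
      then show ?thesis by simp
    qed
    ultimately show ?thesis by simp
  qed
  then show ?thesis
    by (rule that[OF r M])
qed

lemma bits_subsequence:
  fixes \<gamma> :: "nat \<Rightarrow> 'b measure" and B :: "'k::countable \<Rightarrow> 'b set"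
  assumes prob: "\<And>n. prob_space (\<gamma> n)" and sets: "\<And>n. sets (\<gamma> n) = sets K"
    and B: "\<And>k. B k \<in> sets K"
  obtains r M where "strict_mono r" "real_distribution M"
    "\<And>J. finite J \<Longrightarrow>
       (\<lambda>n. measure (\<gamma> (r n)) {x \<in> space K. \<forall>k\<in>J. x \<in> B k}) \<longlonglongrightarrow>
       measure M {t. \<forall>k\<in>J. digit (to_nat k) t = 1}"
proof -
  obtain r M where rM: "strict_mono r" "real_distribution M"
    and lim: "\<And>J. finite J \<Longrightarrow>
       (\<lambda>n. measure (\<gamma> (r n)) {x \<in> space K. \<forall>k\<in>J. x \<in> B (from_nat k)}) \<longlonglongrightarrow>
       measure M {t. \<forall>k\<in>J. digit k t = 1}"
    by (rule bits_subsequence_nat[of \<gamma> K "\<lambda>k. B (from_nat k)", OF prob sets B]) blast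
  show ?thesis
  proof (rule that[OF rM])
    fix J :: "'k set" assume "finite J"
    with lim[of "to_nat ` J"]
    show "(\<lambda>n. measure (\<gamma> (r n)) {x \<in> space K. \<forall>k\<in>J. x \<in> B k}) \<longlonglongrightarrow>
       measure M {t. \<forall>k\<in>J. digit (to_nat k) t = 1}"
      by simp
  qed
qed

section \<open>Compactness of the set of couplings\<close>

definition cyl :: "'b measure \<Rightarrow> ('k \<Rightarrow> 'b set) \<Rightarrow> 'k set \<Rightarrow> 'b set" where
  "cyl K B J = {x \<in> space K. \<forall>k\<in>J. x \<in> B k}"

lemma cyl_empty: "cyl K B {} = space K"
  by (simp add: cyl_def)

lemma cyl_Un: "cyl K B (I \<union> J) = cyl K B I \<inter> cyl K B J"
  by (auto simp: cyl_def)

lemma cyl_sets: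
  assumes "\<And>k. B k \<in> sets K" "finite J"
  shows "cyl K B J \<in> sets K"
  unfolding cyl_def using assms by (intro sets.sets_Collect_finite_All) (auto intro: sets.sets_Collect)

lemma Int_stable_cyl: "Int_stable (cyl K B ` {J. finite J})"
  by (auto simp: Int_stable_def cyl_Un[symmetric])

lemma cyl_generates:
  assumes gen: "sets K = sigma_sets (space K) (range B)"
  shows "sets K = sigma_sets (space K) (cyl K B ` {J. finite J})"
proof (rule antisym)
  have B: "B k \<in> sets K" for k
    unfolding gen by (intro sigma_sets.Basic) simp
  then show "sigma_sets (space K) (cyl K B ` {J. finite J}) \<subseteq> sets K"
    by (intro sets.sigma_sets_subset) (auto intro: cyl_sets)
  have "B k \<in> cyl K B ` {J. finite J}" for k
    using sets.sets_into_space[OF B, of k] by (intro image_eqI[of _ _ "{k}"]) (auto simp: cyl_def)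
  then show "sets K \<subseteq> sigma_sets (space K) (cyl K B ` {J. finite J})"
    unfolding gen by (intro sigma_sets_mono') auto
qed

lemma prob_eqI_cyl:
  assumes P: "prob_space P" "sets P = sets K" and Q: "prob_space Q" "sets Q = sets K"
    and gen: "sets K = sigma_sets (space K) (range B)"
    and eq: "\<And>J. finite J \<Longrightarrow> measure P (cyl K B J) = measure Q (cyl K B J)"
  shows "P = Q"
proof (rule measure_eqI_generator_eq[OF Int_stable_cyl])
  let ?E = "cyl K B ` {J. finite J}"
  show "?E \<subseteq> Pow (space K)"
    by (auto simp: cyl_def)
  show "sets P = sigma_sets (space K) ?E" "sets Q = sigma_sets (space K) ?E"
    using P Q cyl_generates[OF gen] by simp_all
  show "range (\<lambda>_::nat. space K) \<subseteq> ?E"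
    using cyl_empty[of K B] by force
  show "emeasure P (space K) \<noteq> \<infinity>"
    using P finite_measure.emeasure_finite[OF prob_space.finite_measure] by auto
  fix X assume "X \<in> ?E"
  then show "emeasure P X = emeasure Q X"
    using eq P Q by (auto simp: finite_measure.emeasure_eq_measure[OF prob_space.finite_measure])
qed auto

section \<open>Coding points of a Polish space by membership in a countable base\<close>

locale base_sequence =
  fixes U :: "nat \<Rightarrow> 'a::polish_space set"
  assumes open_U: "open (U k)"
    and base: "open V \<Longrightarrow> x \<in> V \<Longrightarrow> \<exists>k. x \<in> U k \<and> U k \<subseteq> V"

lemma base_sequence_exists: "\<exists>U :: nat \<Rightarrow> 'a::polish_space set. base_sequence U"
proof -
  obtain B :: "'a set set" where B: "countable B" "topological_basis B"
    using ex_countable_basis by blast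
  have "B \<noteq> {}"
    using topological_basisE[OF B(2) open_UNIV UNIV_I] by blast
  with B have "base_sequence (from_nat_into B)"
  proof unfold_locales
    show "open (from_nat_into B k)" for k
      using B \<open>B \<noteq> {}\<close> by (auto intro: topological_basis_open from_nat_into)
    show "\<exists>k. x \<in> from_nat_into B k \<and> from_nat_into B k \<subseteq> V" if "open V" "x \<in> V" for V x
      using topological_basisE[OF B(2) that] from_nat_into_surj[OF B(1)] by metis
  qed
  then show ?thesis by blast
qed

abbreviation bool_seq :: "(nat \<Rightarrow> bool) measure" where
  "bool_seq \<equiv> PiM UNIV (\<lambda>_. count_space UNIV)"

lemma measurable_bool_seq:
  assumes "\<And>k. Measurable.pred M (\<lambda>x. b x k)"
  shows "b \<in> measurable M bool_seq"
  using measurable_PiM_single'[of UNIV "\<lambda>k x. b x k" M "\<lambda>_. count_space UNIV"] assms by auto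

text \<open>Puts the sequence space into the form required by \<open>prob_eqI_cyl\<close>: a law of
  bits is determined by the probabilities that finitely many given bits are all true.\<close>

lemma sets_bool_seq: "sets bool_seq = sigma_sets (space bool_seq) (range (\<lambda>k. {\<omega>. \<omega> k}))"
proof (rule antisym)
  let ?S = "sigma UNIV (range (\<lambda>k. {\<omega> :: nat \<Rightarrow> bool. \<omega> k}))"
  have "Measurable.pred ?S (\<lambda>\<omega>. \<omega> k)" for k
    unfolding pred_def by auto
  then have "(\<lambda>\<omega>. \<omega>) \<in> measurable ?S bool_seq"
    by (rule measurable_bool_seq)
  from measurable_sets[OF this]
  show "sets bool_seq \<subseteq> sigma_sets (space bool_seq) (range (\<lambda>k. {\<omega>. \<omega> k}))"
    by (auto simp: space_PiM)
  have "{\<omega>. \<omega> k} \<in> sets bool_seq" for k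
  proof -
    have "{\<omega> \<in> space bool_seq. \<omega> k} \<in> sets bool_seq" by measurable
    then show ?thesis by (simp add: space_PiM)
  qed
  then show "sigma_sets (space bool_seq) (range (\<lambda>k. {\<omega>. \<omega> k})) \<subseteq> sets bool_seq"
    by (intro sets.sigma_sets_subset) auto
qed

context base_sequence
begin

text \<open>
  A point is recovered from its code by a measurable map, the limit of \<open>approx\<close>; on sequences that code
  no point the value of \<open>decode\<close> is irrelevant.
\<close>

definition center :: "nat \<Rightarrow> 'a" where
  "center k = (SOME x. x \<in> U k)"

text \<open>For the code of \<open>x\<close>, the selected base set contains \<open>x\<close> and
  lies in the ball of radius 1/(n+1) about its center, so the center is that close to
  \<open>x\<close>. Taking the least index makes the choice a measurable function of the
  bits.\<close>

definition approx :: "nat \<Rightarrow> (nat \<Rightarrow> bool) \<Rightarrow> 'a" where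
  "approx n \<omega> = center (LEAST k. \<omega> k \<and> U k \<subseteq> ball (center k) (1 / real (Suc n)))"

definition decode :: "(nat \<Rightarrow> bool) \<Rightarrow> 'a" where
  "decode \<omega> = (if Cauchy (\<lambda>n. approx n \<omega>) then lim (\<lambda>n. approx n \<omega>) else undefined)"

definition code :: "'a \<Rightarrow> nat \<Rightarrow> bool" where
  "code x k \<longleftrightarrow> x \<in> U k"

lemma U_measurable [measurable]: "U k \<in> sets borel"
  using open_U by simp

lemma approx_measurable: "approx n \<in> borel_measurable bool_seq"
proof -
  have "(\<lambda>\<omega>. LEAST k. \<omega> k \<and> U k \<subseteq> ball (center k) (1 / real (Suc n))) \<in>
        measurable bool_seq (count_space UNIV)"
    by measurable
  then show ?thesis
    unfolding approx_def[abs_def] by (rule measurable_compose) simp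
qed

text \<open>The approximants are frozen at \<open>undefined\<close> off the measurable set of Cauchy
  sequences, so that they converge at every \<omega>.\<close>

lemma decode_measurable: "decode \<in> borel_measurable bool_seq"
proof (rule borel_measurable_LIMSEQ_metric)
  note [measurable] = approx_measurable
  show "(\<lambda>\<omega>. if Cauchy (\<lambda>n. approx n \<omega>) then approx n \<omega> else undefined)
    \<in> borel_measurable bool_seq" for n
    by measurable
  fix \<omega>
  show "(\<lambda>n. if Cauchy (\<lambda>n. approx n \<omega>) then approx n \<omega> else undefined) \<longlonglongrightarrow> decode \<omega>"
    by (auto simp: decode_def Cauchy_convergent_iff convergent_LIMSEQ_iff)
qed

lemma code_measurable: "code \<in> measurable borel bool_seq"
  unfolding code_def[abs_def] by (rule measurable_bool_seq) measurable

lemma decode_code: "decode (code x) = x"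
proof -
  have "dist (approx n (code x)) x < 1 / real (Suc n)" for n
  proof -
    let ?P = "\<lambda>k. code x k \<and> U k \<subseteq> ball (center k) (1 / real (Suc n))"
    \<comment> \<open>Half the radius: the center is only known to lie in \<open>U k\<close>, so its
      distance to another point of \<open>U k\<close> is estimated through \<open>x\<close>.\<close>
    obtain k where k: "x \<in> U k" "U k \<subseteq> ball x (1 / (2 * real (Suc n)))"
      using base[of "ball x (1 / (2 * real (Suc n)))" x] by auto
    then have "center k \<in> U k"
      unfolding center_def by (metis someI)
    have "U k \<subseteq> ball (center k) (1 / real (Suc n))"
    proof
      fix y assume "y \<in> U k"
      then have "dist x y < 1 / (2 * real (Suc n))" "dist x (center k) < 1 / (2 * real (Suc n))"
        using k \<open>center k \<in> U k\<close> by auto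
      moreover have "1 / real (Suc n) = 1 / (2 * real (Suc n)) + 1 / (2 * real (Suc n))"
        by (simp add: field_simps)
      ultimately show "y \<in> ball (center k) (1 / real (Suc n))"
        using dist_triangle3[of "center k" y x] by (simp only: mem_ball)
    qed
    with k have "?P k" by (simp add: code_def)
    then have "?P (LEAST k. ?P k)" by (rule LeastI)
    then show ?thesis
      unfolding approx_def by (auto simp: code_def)
  qed
  then have "(\<lambda>n. dist (approx n (code x)) x) \<longlonglongrightarrow> 0"
    by (intro tendsto_sandwich[OF _ _ tendsto_const LIMSEQ_inverse_real_of_nat])
       (auto intro!: always_eventually less_imp_le simp: inverse_eq_divide)
  then have "(\<lambda>n. approx n (code x)) \<longlonglongrightarrow> x"
    by (subst tendsto_dist_iff)
  then show ?thesis
    by (auto simp: decode_def Cauchy_convergent_iff convergent_def limI)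
qed

text \<open>An index whose first component is at least \<open>N\<close> gives the whole space. All
  of nat times nat, a countable type, can thus index the bits.\<close>

definition slab :: "nat \<Rightarrow> nat \<times> nat \<Rightarrow> (nat \<Rightarrow> 'a) set" where
  "slab N j = {x \<in> space (borel_N N). fst j < N \<longrightarrow> x (fst j) \<in> U (snd j)}"

abbreviation box :: "nat \<Rightarrow> (nat \<times> nat) set \<Rightarrow> (nat \<Rightarrow> 'a) set" where
  "box N J \<equiv> cyl (borel_N N) (slab N) J"

lemma slab_sets: "slab N j \<in> sets (borel_N N)"
proof (cases "fst j < N")
  case True
  then have "(\<lambda>x. x (fst j)) \<in> measurable (borel_N N :: (nat \<Rightarrow> 'a) measure) borel"
    by (intro measurable_component_singleton) auto
  from measurable_sets[OF this U_measurable[of "snd j"]] show ?thesis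
    using True by (simp add: slab_def vimage_def Int_def conj_commute)
qed (simp add: slab_def)

lemma box_sets: "finite J \<Longrightarrow> box N J \<in> sets (borel_N N)"
  by (intro cyl_sets slab_sets)

text \<open>Every open set is a countable union of base sets, so the coordinate maps are already
  measurable for the sigma-algebra generated by the slabs.\<close>

lemma sets_borel_N_eq_sigma_slab:
  "sets (borel_N N) = sigma_sets (space (borel_N N)) (range (slab N))"
proof (rule antisym)
  let ?\<Omega> = "space (borel_N N) :: (nat \<Rightarrow> 'a) set"
  let ?S = "sigma ?\<Omega> (range (slab N))"
  have sub: "range (slab N) \<subseteq> Pow ?\<Omega>"
    by (auto simp: slab_def)
  have sp: "space ?S = ?\<Omega>"
    by (rule space_measure_of[OF sub])
  have "(\<lambda>x. x i) \<in> borel_measurable ?S" if "i < N" for i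
  proof (rule borel_measurableI)
    fix V :: "'a set" assume V: "open V"
    have "(\<lambda>x. x i) -` V \<inter> space ?S = (\<Union>k\<in>{k. U k \<subseteq> V}. slab N (i, k))"
      using base[OF V] that unfolding sp by (fastforce simp: slab_def)
    also have "\<dots> \<in> sets ?S"
      using sub by (intro sets.countable_UN'') auto
    finally show "(\<lambda>x. x i) -` V \<inter> space ?S \<in> sets ?S" .
  qed
  moreover have "(\<lambda>x i. x i) \<in> space ?S \<rightarrow> ({..<N} \<rightarrow>\<^sub>E space (borel :: 'a measure))"
    unfolding sp by (auto simp: space_PiM)
  ultimately have "(\<lambda>x i. x i) \<in> measurable ?S (borel_N N)"
    by (intro measurable_PiM_single') auto
  from measurable_sets[OF this] have "A \<inter> ?\<Omega> \<in> sets ?S" if "A \<in> sets (borel_N N)" for A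
    using that sp by (auto simp: vimage_def)
  then show "sets (borel_N N) \<subseteq> sigma_sets ?\<Omega> (range (slab N))"
    using sets.sets_into_space sub by (metis Int_absorb2 sets_measure_of subsetI)
  show "sigma_sets ?\<Omega> (range (slab N)) \<subseteq> sets (borel_N N)"
    by (intro sets.sigma_sets_subset) (auto intro: slab_sets)
qed

text \<open>Unlike in weak convergence, no condition that boundaries be null is imposed on the
  boxes.\<close>

definition box_conv :: "nat \<Rightarrow> (nat \<Rightarrow> (nat \<Rightarrow> 'a) measure) \<Rightarrow> (nat \<Rightarrow> 'a) measure \<Rightarrow> bool" where
  "box_conv N G \<gamma> \<longleftrightarrow>
     (\<forall>J. finite J \<longrightarrow> (\<lambda>n. measure (G n) (box N J)) \<longlonglongrightarrow> measure \<gamma> (box N J))"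

end

section \<open>Sequential compactness of the symmetric couplings\<close>

lemma Pi_symD:
  assumes "\<gamma> \<in> Pi_sym N \<mu>"
  shows "sets \<gamma> = sets (borel_N N)" "prob_space \<gamma>" "space \<gamma> = space (borel_N N)"
    "\<And>\<pi>. \<pi> permutes {..<N} \<Longrightarrow>
        distr \<gamma> (borel_N N) (\<lambda>x. restrict (\<lambda>i. x (\<pi> i)) {..<N}) = \<gamma>"
    "\<And>i. i < N \<Longrightarrow> distr \<gamma> borel (\<lambda>x. x i) = \<mu>"
  using assms sets_eq_imp_space_eq[of \<gamma> "borel_N N"] by (auto simp: Pi_sym_def)

lemma component_measurable:
  assumes "sets \<gamma> = sets (borel_N N)" "i < N"
  shows "(\<lambda>x. x i) \<in> borel_measurable \<gamma>"
  using measurable_component_singleton[of i "{..<N}" "\<lambda>_. borel"] assms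
  by (simp cong: measurable_cong_sets)

context base_sequence
begin

text \<open>The limit law \<open>M\<close> of all bits is turned into a coupling by decoding,
  coordinate by coordinate, the bits that belong to that coordinate. Only the joint law of the
  coordinates changes along the sequence, and no compactness of X itself enters.\<close>

theorem Pi_sym_sequentially_compact:
  fixes G :: "nat \<Rightarrow> (nat \<Rightarrow> 'a) measure"
  assumes \<mu>: "prob_space \<mu>" "sets \<mu> = sets borel" and G: "\<And>n. G n \<in> Pi_sym N \<mu>"
  obtains r \<gamma> where "strict_mono r" "\<gamma> \<in> Pi_sym N \<mu>" "box_conv N (\<lambda>n. G (r n)) \<gamma>"
proof -
  note GD = Pi_symD[OF G]
  interpret \<mu>: prob_space \<mu> by fact
  obtain r M where r: "strict_mono r" and M: "real_distribution M"
    and lim: "\<And>J. finite J \<Longrightarrow> (\<lambda>n. measure (G (r n)) (box N J)) \<longlonglongrightarrow>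
       measure M {t. \<forall>j\<in>J. digit (to_nat j) t = 1}"
    using bits_subsequence[of G "borel_N N" "slab N", OF GD(2) GD(1) slab_sets]
    unfolding cyl_def by blast
  interpret M: real_distribution M by fact
  define b where "b i t = (\<lambda>k. digit (to_nat (i :: nat, k :: nat)) t = 1)" for i t
  have b[measurable]: "b i \<in> measurable M bool_seq" for i
    unfolding b_def[abs_def] by (rule measurable_bool_seq) simp
  note [measurable] = decode_measurable code_measurable
  have [measurable_cong]: "sets \<mu> = sets borel" by fact
  \<comment> \<open>Events about one coordinate have a probability independent of \<open>n\<close>,
    since each \<open>G n\<close> has marginal \<mu>. The limit is thus an equality of laws.\<close>
  have law: "distr M bool_seq (b i) = distr \<mu> bool_seq code" if i: "i < N" for i
  proof (rule prob_eqI_cyl[OF _ _ _ _ sets_bool_seq])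
    show "prob_space (distr M bool_seq (b i))" "prob_space (distr \<mu> bool_seq code)"
      by (auto intro!: M.prob_space_distr \<mu>.prob_space_distr)
    fix J :: "nat set" assume J: "finite J"
    let ?C = "cyl bool_seq (\<lambda>k. {\<omega>. \<omega> k}) J"
    have C: "?C \<in> sets bool_seq"
      using J by (intro cyl_sets) (auto simp: sets_bool_seq)
    have "(\<lambda>n. measure (G (r n)) (box N (Pair i ` J))) \<longlonglongrightarrow> measure M {t. \<forall>k\<in>J. b i t k}"
      using lim[of "Pair i ` J"] J by (simp add: b_def)
    moreover have "measure (G (r n)) (box N (Pair i ` J)) = measure \<mu> {x. \<forall>k\<in>J. code x k}" for n
    proof -
      have m: "{x. \<forall>k\<in>J. code x k} \<in> sets borel"
        using J unfolding code_def by measurable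
      have "measure \<mu> {x. \<forall>k\<in>J. code x k} =
            measure (distr (G (r n)) borel (\<lambda>x. x i)) {x. \<forall>k\<in>J. code x k}"
        using GD(5)[OF i] by simp
      also have "\<dots> = measure (G (r n)) (box N (Pair i ` J))"
        using m i GD(3)
        by (subst measure_distr[OF component_measurable[OF GD(1) i]])
          (auto simp: cyl_def slab_def code_def intro!: arg_cong[of _ _ "measure _"])
      finally show ?thesis ..
    qed
    ultimately have "measure M {t. \<forall>k\<in>J. b i t k} = measure \<mu> {x. \<forall>k\<in>J. code x k}"
      by (simp add: LIMSEQ_const_iff)
    then show "measure (distr M bool_seq (b i)) ?C = measure (distr \<mu> bool_seq code) ?C"
      using C sets_eq_imp_space_eq[OF \<mu>(2)]
      by (simp add: measure_distr) (simp add: cyl_def vimage_def space_PiM)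
  qed (simp_all add: sets_bool_seq)
  \<comment> \<open>Being the code of one's own decoding is a measurable property of bit sequences
    that every genuine code has. It passes to \<open>b i\<close> because the two laws agree.\<close>
  have dec: "AE t in M. \<forall>k. decode (b i t) \<in> U k \<longleftrightarrow> b i t k" if i: "i < N" for i
  proof -
    have "AE \<omega> in distr \<mu> bool_seq code. \<forall>k. decode \<omega> \<in> U k \<longleftrightarrow> \<omega> k"
      by (subst AE_distr_iff) (auto simp: decode_code code_def)
    then have "AE \<omega> in distr M bool_seq (b i). \<forall>k. decode \<omega> \<in> U k \<longleftrightarrow> \<omega> k"
      unfolding law[OF i] .
    then show ?thesis
      by (rule AE_distrD[OF b])
  qed
  define \<phi> where "\<phi> t = (\<lambda>i\<in>{..<N}. decode (b i t))" for t
  have \<phi>[measurable]: "\<phi> \<in> measurable M (borel_N N)"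
    unfolding \<phi>_def[abs_def] by measurable
  define \<gamma> where "\<gamma> = distr M (borel_N N) \<phi>"
  have \<gamma>: "prob_space \<gamma>" "sets \<gamma> = sets (borel_N N)"
    by (auto simp: \<gamma>_def intro!: M.prob_space_distr)
  have "box_conv N (\<lambda>n. G (r n)) \<gamma>"
    unfolding box_conv_def
  proof (intro allI impI)
    fix J :: "(nat \<times> nat) set" assume J: "finite J"
    \<comment> \<open>Indices beyond \<open>N\<close> constrain nothing in the box, and
      \<open>dec\<close> gives no information on their digits.\<close>
    define J' where "J' = {j \<in> J. fst j < N}"
    have J': "finite J'" using J by (simp add: J'_def)
    have bJ: "box N J = box N J'"
      by (auto simp: cyl_def slab_def J'_def)
    have "measure \<gamma> (box N J') = measure M {t \<in> space M. \<phi> t \<in> box N J'}"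
      unfolding \<gamma>_def using J'
      by (subst measure_distr) (auto intro: box_sets simp: vimage_def Int_def conj_commute)
    also have "\<dots> = measure M {t \<in> space M. \<forall>j\<in>J'. digit (to_nat j) t = 1}"
    proof (rule M.finite_measure_eq_AE)
      have "AE t in M. \<forall>i\<in>{..<N}. \<forall>k. decode (b i t) \<in> U k \<longleftrightarrow> b i t k"
        using dec by (intro AE_finite_allI) auto
      then show "AE t in M. t \<in> {t \<in> space M. \<phi> t \<in> box N J'} \<longleftrightarrow>
          t \<in> {t \<in> space M. \<forall>j\<in>J'. digit (to_nat j) t = 1}"
        by eventually_elim
          (fastforce simp: cyl_def slab_def J'_def \<phi>_def space_PiM b_def)
      show "{t \<in> space M. \<phi> t \<in> box N J'} \<in> sets M"
        using measurable_sets[OF \<phi> box_sets[OF J']] by (simp add: vimage_def)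
    qed (use J' in simp)
    finally have "measure \<gamma> (box N J') = measure M {t. \<forall>j\<in>J'. digit (to_nat j) t = 1}"
      by simp
    with lim[OF J'] show "(\<lambda>n. measure (G (r n)) (box N J)) \<longlonglongrightarrow> measure \<gamma> (box N J)"
      by (simp add: bJ)
  qed
  moreover have "\<gamma> \<in> Pi_sym N \<mu>"
    unfolding Pi_sym_def
  proof (intro CollectI conjI allI impI \<gamma>)
    fix i assume i: "i < N"
    have "distr \<gamma> borel (\<lambda>x. x i) = distr M borel (\<lambda>t. decode (b i t))"
      unfolding \<gamma>_def using i component_measurable[OF refl i]
      by (subst distr_distr) (auto simp: o_def \<phi>_def)
    also have "\<dots> = distr (distr M bool_seq (b i)) borel decode"
      by (subst distr_distr) (auto simp: o_def)
    also have "\<dots> = distr \<mu> borel (\<lambda>x. x)"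
      unfolding law[OF i] by (subst distr_distr) (auto simp: o_def decode_code)
    also have "\<dots> = \<mu>"
      by (intro distr_id2) (simp add: \<mu>(2))
    finally show "distr \<gamma> borel (\<lambda>x. x i) = \<mu>" .
  next
    fix \<pi> assume \<pi>: "\<pi> permutes {..<N}"
    let ?T = "\<lambda>x. restrict (\<lambda>i. x (\<pi> i)) {..<N} :: nat \<Rightarrow> 'a"
    have \<pi>N: "\<pi> i < N" if "i < N" for i
      using permutes_in_image[OF \<pi>, of i] that by simp
    have T: "?T \<in> measurable K (borel_N N)" if "sets K = sets (borel_N N)" for K
      using component_measurable[OF that] \<pi>N by (intro measurable_restrict) auto
    show "distr \<gamma> (borel_N N) ?T = \<gamma>"
    proof (rule prob_eqI_cyl[OF _ _ \<gamma> sets_borel_N_eq_sigma_slab])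
      show "prob_space (distr \<gamma> (borel_N N) ?T)"
        by (intro prob_space.prob_space_distr \<gamma> T)
      fix J :: "(nat \<times> nat) set" assume J: "finite J"
      \<comment> \<open>The preimage of a box under the permutation is the box with its coordinates
        moved by \<pi>, so invariance can be checked on boxes and passed to the limit there.\<close>
      define J' where "J' = (\<lambda>(i, k). (\<pi> i, k)) ` {j \<in> J. fst j < N}"
      have J': "finite J'" using J by (simp add: J'_def)
      have inv: "?T -` box N J \<inter> space (borel_N N) = box N J'"
        using \<pi>N by (fastforce simp: cyl_def slab_def J'_def space_PiM)
      have d: "measure (distr K (borel_N N) ?T) (box N J) = measure K (box N J')"
        if "sets K = sets (borel_N N)" for K
        using inv sets_eq_imp_space_eq[OF that] by (simp add: measure_distr[OF T[OF that] box_sets[OF J]])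
      have "measure (G n) (box N J') = measure (G n) (box N J)" for n
        using d[OF GD(1), of n] by (simp add: GD(4)[OF \<pi>])
      moreover have "(\<lambda>n. measure (G (r n)) (box N J)) \<longlonglongrightarrow> measure \<gamma> (box N J)"
        "(\<lambda>n. measure (G (r n)) (box N J')) \<longlonglongrightarrow> measure \<gamma> (box N J')"
        using \<open>box_conv N (\<lambda>n. G (r n)) \<gamma>\<close> J J' by (auto simp: box_conv_def)
      ultimately have "measure \<gamma> (box N J') = measure \<gamma> (box N J)"
        by (simp add: LIMSEQ_unique)
      then show "measure (distr \<gamma> (borel_N N) ?T) (box N J) = measure \<gamma> (box N J)"
        by (simp add: d[OF \<gamma>(2)])
    qed simp
  qed
  ultimately show ?thesis
    using that[OF r] by blast
qed

end

section \<open>Box convergence on unions of boxes and on open sets\<close>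

context base_sequence
begin

text \<open>The factor \<open>box N I\<close> is what lets the induction close: inclusion-exclusion
  subtracts the overlap of \<open>box N J\<close> with the other boxes, which has the same shape
  with \<open>I\<close> enlarged to \<open>I \<union> J\<close>.\<close>

lemma box_conv_Union:
  assumes conv: "box_conv N G \<gamma>"
    and G: "\<And>n. prob_space (G n)" "\<And>n. sets (G n) = sets (borel_N N)"
    and \<gamma>: "prob_space \<gamma>" "sets \<gamma> = sets (borel_N N)"
    and F: "finite F" "\<And>J. J \<in> F \<Longrightarrow> finite J" and I: "finite I"
  shows "(\<lambda>n. measure (G n) (box N I \<inter> (\<Union>J\<in>F. box N J))) \<longlonglongrightarrow>
      measure \<gamma> (box N I \<inter> (\<Union>J\<in>F. box N J))"
  using F I
proof (induction F arbitrary: I rule: finite_induct)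
  case empty
  show ?case by simp
next
  case (insert J F)
  let ?V = "\<Union>J\<in>F. box N J"
  have fin: "finite J" "\<And>J. J \<in> F \<Longrightarrow> finite J"
    using insert.prems by auto
  have V: "?V \<in> sets (borel_N N)"
    using insert.hyps(1) fin(2) by (intro sets.finite_UN box_sets)
  have split: "measure Q (box N I \<inter> (\<Union>J\<in>insert J F. box N J)) =
      measure Q (box N (I \<union> J)) + measure Q (box N I \<inter> ?V) - measure Q (box N (I \<union> J) \<inter> ?V)"
    if Q: "prob_space Q" "sets Q = sets (borel_N N)" for Q
  proof -
    interpret Q: prob_space Q by fact
    have "box N (I \<union> J) \<in> sets Q" "box N I \<inter> ?V \<in> sets Q"
      using V insert.prems(2) fin(1) by (auto simp: Q intro!: box_sets)
    from measure_Un3[OF this[folded Q.fmeasurable_eq_sets]]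
    have "measure Q (box N (I \<union> J) \<union> (box N I \<inter> ?V)) =
        measure Q (box N (I \<union> J)) + measure Q (box N I \<inter> ?V) -
        measure Q (box N (I \<union> J) \<inter> (box N I \<inter> ?V))" .
    moreover have "box N (I \<union> J) \<union> (box N I \<inter> ?V) = box N I \<inter> (\<Union>J\<in>insert J F. box N J)"
      "box N (I \<union> J) \<inter> (box N I \<inter> ?V) = box N (I \<union> J) \<inter> ?V"
      by (auto simp: cyl_Un)
    ultimately show ?thesis by simp
  qed
  show ?case
    unfolding split[OF G] split[OF \<gamma>]
    using conv insert.prems(2) fin
    by (intro tendsto_add tendsto_diff insert.IH) (auto simp: box_conv_def)
qed

text \<open>\<open>V\<close> is exhausted by finite unions of base rectangles. On each of them the
  masses converge; taking the supremum of these limits leaves an inequality. Two coordinates suffice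
  because the cost is a sum over pairs.\<close>

lemma box_conv_open_pair:
  assumes conv: "box_conv N G \<gamma>"
    and G: "\<And>n. prob_space (G n)" "\<And>n. sets (G n) = sets (borel_N N)"
    and \<gamma>: "prob_space \<gamma>" "sets \<gamma> = sets (borel_N N)"
    and ij: "i < N" "j < N" and V: "open V"
  shows "emeasure \<gamma> {x \<in> space (borel_N N). (x i, x j) \<in> V} \<le>
      liminf (\<lambda>n. emeasure (G n) {x \<in> space (borel_N N). (x i, x j) \<in> V})"
proof -
  let ?S = "{x \<in> space (borel_N N). (x i, x j) \<in> V}"
  define F where "F m = (\<lambda>(k, l). {(i, k), (j, l)}) ` {p \<in> {..m} \<times> {..m}. U (fst p) \<times> U (snd p) \<subseteq> V}"
    for m :: nat
  define A where "A m = (\<Union>J\<in>F m. box N J)" for m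
  have F: "finite (F m)" "\<And>J. J \<in> F m \<Longrightarrow> finite J" for m
    by (auto simp: F_def)
  have A_sets: "A m \<in> sets (borel_N N)" for m
    unfolding A_def using F by (intro sets.finite_UN box_sets)
  have "incseq A"
  proof (rule monoI)
    fix m n :: nat assume "m \<le> n"
    then have "F m \<subseteq> F n"
      unfolding F_def by (intro image_mono) auto
    then show "A m \<subseteq> A n" by (auto simp: A_def)
  qed
  have "(\<Union>m. A m) = ?S"
  proof (intro equalityI subsetI)
    fix x assume "x \<in> (\<Union>m. A m)"
    then obtain k l where kl: "x \<in> box N {(i, k), (j, l)}" "U k \<times> U l \<subseteq> V"
      by (auto simp: A_def F_def)
    then have "x \<in> space (borel_N N)" "x i \<in> U k" "x j \<in> U l"
      using ij by (simp_all add: cyl_def slab_def)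
    with kl(2) show "x \<in> ?S" by blast
  next
    fix x assume x: "x \<in> ?S"
    then have "(x i, x j) \<in> V" by simp
    then obtain S T where "open S" "open T" "(x i, x j) \<in> S \<times> T" "S \<times> T \<subseteq> V"
      by (rule open_prod_elim[OF V])
    then have ST: "open S" "open T" "x i \<in> S" "x j \<in> T" "S \<times> T \<subseteq> V"
      by simp_all
    obtain k l where "x i \<in> U k" "U k \<subseteq> S" "x j \<in> U l" "U l \<subseteq> T"
      using base[OF ST(1,3)] base[OF ST(2,4)] by blast
    with ST x have "x \<in> box N {(i, k), (j, l)}" "U k \<times> U l \<subseteq> V"
      by (simp add: cyl_def slab_def, blast)
    then have "{(i, k), (j, l)} \<in> F (max k l)" "x \<in> box N {(i, k), (j, l)}"
      unfolding F_def by (auto intro!: image_eqI[of _ _ "(k, l)"])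
    then show "x \<in> (\<Union>m. A m)"
      unfolding A_def by blast
  qed
  moreover have "range A \<subseteq> sets \<gamma>"
    using A_sets \<gamma>(2) by auto
  ultimately have "emeasure \<gamma> ?S = (SUP m. emeasure \<gamma> (A m))"
    using \<open>incseq A\<close> by (simp add: SUP_emeasure_incseq)
  also have "\<dots> \<le> liminf (\<lambda>n. emeasure (G n) ?S)"
  proof (rule SUP_least)
    fix m
    have "(\<lambda>n. measure (G n) (box N {} \<inter> A m)) \<longlonglongrightarrow> measure \<gamma> (box N {} \<inter> A m)"
      unfolding A_def by (intro box_conv_Union[OF conv G \<gamma> F]) auto
    moreover have "box N {} \<inter> A m = A m"
      using sets.sets_into_space[OF A_sets[of m]] by (auto simp: cyl_empty)
    ultimately have "(\<lambda>n. ennreal (measure (G n) (A m))) \<longlonglongrightarrow> ennreal (measure \<gamma> (A m))"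
      by (intro tendsto_ennrealI) simp
    then have "(\<lambda>n. emeasure (G n) (A m)) \<longlonglongrightarrow> emeasure \<gamma> (A m)"
      using G(1) \<gamma>(1) by (simp add: finite_measure.emeasure_eq_measure[OF prob_space.finite_measure])
    then have "emeasure \<gamma> (A m) = liminf (\<lambda>n. emeasure (G n) (A m))"
      by (simp add: lim_imp_Liminf)
    also have "\<dots> \<le> liminf (\<lambda>n. emeasure (G n) ?S)"
    proof (intro Liminf_mono always_eventually allI emeasure_mono)
      show "A m \<subseteq> ?S"
        using \<open>(\<Union>m. A m) = ?S\<close> by blast
      have "(\<Union>m. A m) \<in> sets (G n)" for n
        using A_sets G(2) by auto
      then show "?S \<in> sets (G n)" for n
        using \<open>(\<Union>m. A m) = ?S\<close> by simp
    qed
    finally show "emeasure \<gamma> (A m) \<le> liminf (\<lambda>n. emeasure (G n) ?S)" .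
  qed
  finally show ?thesis .
qed

end

text \<open>Fatou's lemma for the counting measure on \<open>I\<close>.\<close>

lemma sum_liminf_le:
  fixes u :: "'i \<Rightarrow> nat \<Rightarrow> ennreal"
  assumes "finite I"
  shows "(\<Sum>i\<in>I. liminf (u i)) \<le> liminf (\<lambda>n. \<Sum>i\<in>I. u i n)"
  using nn_integral_liminf[of "\<lambda>n i. u i n" "count_space I"] assms
  by (simp add: nn_integral_count_space_finite)

section \<open>Relative entropy\<close>

text \<open>The affine terms make the function nonnegative, with minimum 0 at t = 1, so that
  entropies can be valued in \<open>ennreal\<close>.\<close>

definition ent_fn :: "real \<Rightarrow> real" where
  "ent_fn t = t * ln t - t + 1"

text \<open>Convexity: the left-hand side is the tangent at \<open>s\<close>, of slope ln s,
  evaluated at \<open>t\<close>.\<close>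

lemma ent_fn_tangent:
  assumes "0 \<le> t" "0 < s"
  shows "t * ln s - s + 1 \<le> ent_fn t"
proof (cases "t = 0")
  case False
  with assms have t: "0 < t" by simp
  have "t * ln (s / t) \<le> t * (s / t - 1)"
    using t assms by (intro mult_left_mono ln_le_minus_one) auto
  with t assms show ?thesis
    by (simp add: ent_fn_def ln_div algebra_simps)
qed (use assms in \<open>simp add: ent_fn_def\<close>)

lemma ent_fn_nonneg: "0 \<le> t \<Longrightarrow> 0 \<le> ent_fn t"
  using ent_fn_tangent[of t 1] by simp

text \<open>Above the threshold exp (1 + L) one has ln t - 1 \<ge> L, hence \<open>ent_fn t\<close>
  exceeds L t; below it the constant is enough.\<close>

lemma ent_fn_superlinear:
  assumes "0 \<le> t" "0 < L"
  shows "t \<le> exp (1 + L) + ent_fn t / L"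
proof (cases "t \<le> exp (1 + L)")
  case True
  then show ?thesis using assms ent_fn_nonneg[of t] by (simp add: add_increasing2)
next
  case False
  then have t: "0 < t"
    using less_trans[OF exp_gt_zero, of "1 + L" t] by simp
  with False have "1 + L \<le> ln t"
    by (simp add: ln_ge_iff)
  with t have "t * (1 + L) \<le> t * ln t" by simp
  then have "t * L \<le> ent_fn t"
    by (simp add: ent_fn_def algebra_simps)
  then have "t \<le> ent_fn t / L"
    using assms by (simp add: pos_le_divide_eq)
  then show ?thesis by (simp add: add_increasing)
qed

lemma ent_fn_measurable [measurable]: "ent_fn \<in> borel_measurable borel"
  unfolding ent_fn_def[abs_def] by measurable

text \<open>For probability measures this is the Kullback-Leibler divergence, since the affine terms
  of \<open>ent_fn\<close> then integrate to zero.\<close>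

definition rel_ent :: "'b measure \<Rightarrow> 'b measure \<Rightarrow> ennreal" where
  "rel_ent P \<gamma> =
     (if absolutely_continuous P \<gamma> then \<integral>\<^sup>+x. ent_fn (enn2real (RN_deriv P \<gamma> x)) \<partial>P else \<infinity>)"

lemma rel_ent_density:
  assumes "sigma_finite_measure P" "h \<in> borel_measurable P" "\<And>x. 0 \<le> h x"
  shows "rel_ent P (density P (\<lambda>x. ennreal (h x))) = (\<integral>\<^sup>+x. ent_fn (h x) \<partial>P)"
proof -
  interpret sigma_finite_measure P by fact
  have ac: "absolutely_continuous P (density P (\<lambda>x. ennreal (h x)))"
    using assms by (intro absolutely_continuousI_density) simp
  have "AE x in P. ennreal (h x) = RN_deriv P (density P (\<lambda>x. ennreal (h x))) x"
    using assms by (intro RN_deriv_unique) auto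
  then have "AE x in P. ennreal (ent_fn (enn2real (RN_deriv P (density P (\<lambda>x. ennreal (h x))) x)))
      = ennreal (ent_fn (h x))"
  proof eventually_elim
    case (elim x)
    then show ?case using assms(3)[of x] by (simp flip: elim)
  qed
  then show ?thesis
    unfolding rel_ent_def using ac by (simp add: nn_integral_cong_AE)
qed

lemma real_density_exists:
  assumes "sigma_finite_measure P" "prob_space \<gamma>" "sets \<gamma> = sets P" "absolutely_continuous P \<gamma>"
  obtains h :: "'b \<Rightarrow> real" where "h \<in> borel_measurable P" "\<And>x. 0 \<le> h x"
    "\<gamma> = density P (\<lambda>x. ennreal (h x))"
proof -
  interpret sigma_finite_measure P by fact
  interpret \<gamma>: prob_space \<gamma> by fact
  obtain D where D: "D \<in> borel_measurable P" "AE x in P. RN_deriv P \<gamma> x = ennreal (D x)"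
      "\<And>x. 0 \<le> D x"
    using real_RN_deriv[OF \<gamma>.finite_measure_axioms assms(4,3)] by metis
  have "density P (\<lambda>x. ennreal (D x)) = density P (RN_deriv P \<gamma>)"
    using D by (intro density_cong) auto
  also have "\<dots> = \<gamma>"
    by (rule density_RN_deriv[OF assms(4,3)])
  finally show ?thesis
    using that[of D] D by simp
qed

lemma finite_rel_ent_density:
  assumes "sigma_finite_measure P" "prob_space \<gamma>" "sets \<gamma> = sets P" "rel_ent P \<gamma> < \<infinity>"
  obtains h :: "'b \<Rightarrow> real" where "h \<in> borel_measurable P" "\<And>x. 0 \<le> h x"
    "\<gamma> = density P (\<lambda>x. ennreal (h x))" "rel_ent P \<gamma> = (\<integral>\<^sup>+x. ent_fn (h x) \<partial>P)"
proof -
  have "absolutely_continuous P \<gamma>"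
    using assms(4) by (auto simp: rel_ent_def split: if_splits)
  then obtain h :: "'b \<Rightarrow> real" where "h \<in> borel_measurable P" "\<And>x. 0 \<le> h x"
    "\<gamma> = density P (\<lambda>x. ennreal (h x))"
    using real_density_exists assms(1-3) by metis
  with rel_ent_density[OF assms(1)] that show ?thesis by metis
qed

text \<open>With \<open>L\<close> large, absolute continuity is uniform over all \<open>\<gamma>\<close> with relative entropy at most \<open>C\<close>.\<close>

lemma measure_le_rel_ent:
  assumes P: "prob_space P" and \<gamma>: "prob_space \<gamma>" "sets \<gamma> = sets P"
    and C: "rel_ent P \<gamma> \<le> ennreal C" "0 \<le> C" and L: "0 < L" and A: "A \<in> sets P"
  shows "measure \<gamma> A \<le> exp (1 + L) * measure P A + C / L"
proof -
  interpret P: prob_space P by fact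
  interpret \<gamma>: prob_space \<gamma> by fact
  have "rel_ent P \<gamma> < \<infinity>"
    using C(1) by (auto intro: le_less_trans)
  then obtain h where h[measurable]: "h \<in> borel_measurable P" and h0: "\<And>x. 0 \<le> h x"
    and d: "\<gamma> = density P (\<lambda>x. ennreal (h x))" and r: "rel_ent P \<gamma> = (\<integral>\<^sup>+x. ent_fn (h x) \<partial>P)"
    using finite_rel_ent_density[OF P.sigma_finite_measure_axioms \<gamma>] by metis
  note [measurable] = A
  have "emeasure \<gamma> A = (\<integral>\<^sup>+x. ennreal (h x) * indicator A x \<partial>P)"
    unfolding d by (subst emeasure_density) auto
  also have "\<dots> \<le> (\<integral>\<^sup>+x. ennreal (exp (1 + L)) * indicator A x + ennreal (1 / L) * ent_fn (h x) \<partial>P)"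
  proof (rule nn_integral_mono)
    fix x
    show "ennreal (h x) * indicator A x \<le>
        ennreal (exp (1 + L)) * indicator A x + ennreal (1 / L) * ent_fn (h x)"
    proof (cases "x \<in> A")
      case True
      have "ennreal (h x) \<le> ennreal (exp (1 + L) + 1 / L * ent_fn (h x))"
        using ent_fn_superlinear[OF h0 L, of x] by (intro ennreal_leI) simp
      also have "\<dots> = ennreal (exp (1 + L)) + ennreal (1 / L) * ent_fn (h x)"
        using ent_fn_nonneg[OF h0, of x] L by (subst ennreal_plus, simp, simp, subst ennreal_mult) auto
      finally show ?thesis using True by simp
    qed simp
  qed
  also have "\<dots> = ennreal (exp (1 + L)) * emeasure P A + ennreal (1 / L) * rel_ent P \<gamma>"
    unfolding r by (subst nn_integral_add) (auto simp: nn_integral_cmult)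
  also have "\<dots> \<le> ennreal (exp (1 + L)) * emeasure P A + ennreal (1 / L) * ennreal C"
    by (intro add_mono mult_left_mono C) auto
  also have "\<dots> = ennreal (exp (1 + L) * measure P A + C / L)"
    using L C by (simp add: P.emeasure_eq_measure flip: ennreal_mult ennreal_plus)
  finally have "ennreal (measure \<gamma> A) \<le> ennreal (exp (1 + L) * measure P A + C / L)"
    by (simp only: \<gamma>.emeasure_eq_measure)
  then show ?thesis
    using L C by (subst (asm) ennreal_le_iff) auto
qed

text \<open>A Dynkin induction whose only obstacle is the countable disjoint union: convergence on
  each piece gives convergence on the union only if the tails are small uniformly in
  \<open>n\<close>, and this is what the entropy bound provides.\<close>

lemma setwise_convergence:
  fixes G :: "nat \<Rightarrow> 'b measure"
  assumes P: "prob_space P" and G: "\<And>n. prob_space (G n)" "\<And>n. sets (G n) = sets P"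
    and \<gamma>: "prob_space \<gamma>" "sets \<gamma> = sets P"
    and C: "\<And>n. rel_ent P (G n) \<le> ennreal C" "0 \<le> C"
    and E: "Int_stable E" "E \<subseteq> Pow (space P)" "sets P = sigma_sets (space P) E"
    and conv: "\<And>A. A \<in> E \<Longrightarrow> (\<lambda>n. measure (G n) A) \<longlonglongrightarrow> measure \<gamma> A"
    and A: "A \<in> sets P"
  shows "(\<lambda>n. measure (G n) A) \<longlonglongrightarrow> measure \<gamma> A"
proof -
  interpret P: prob_space P by fact
  interpret \<gamma>: prob_space \<gamma> by fact
  interpret G: prob_space "G n" for n by fact
  have sp: "space \<gamma> = space P" "space (G n) = space P" for n
    using G(2) \<gamma>(2) by (auto dest: sets_eq_imp_space_eq)
  from E(1,2) A[unfolded E(3)] show ?thesis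
  proof (induction rule: sigma_sets_induct_disjoint)
    case (basic A)
    then show ?case by (rule conv)
  next
    case empty
    show ?case by simp
  next
    case (compl A)
    then have "A \<in> sets P" by (simp add: E(3))
    then have "measure (G n) (space P - A) = 1 - measure (G n) A"
      "measure \<gamma> (space P - A) = 1 - measure \<gamma> A" for n
      using G.prob_compl[of A n] \<gamma>.prob_compl[of A] G \<gamma> by (simp_all add: sp)
    with compl show ?case
      by (auto intro: tendsto_diff)
  next
    case (union A)
    then have A: "A i \<in> sets P" for i by (auto simp: E(3))
    define T where "T m = (\<Union>i. A (i + m))" for m
    have T: "T m \<in> sets P" for m
      unfolding T_def using A by auto
    have tail: "(\<lambda>m. measure Q (T m)) \<longlonglongrightarrow> 0 \<and>
        (\<forall>m. measure Q (\<Union>i. A i) = (\<Sum>i<m. measure Q (A i)) + measure Q (T m))"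
      if Q: "prob_space Q" "sets Q = sets P" for Q
    proof -
      interpret Q: prob_space Q by fact
      have s: "(\<lambda>i. measure Q (A i)) sums measure Q (\<Union>i. A i)"
        using A Q union.hyps(1) by (intro Q.finite_measure_UNION) auto
      have "(\<lambda>i. measure Q (A (i + m))) sums measure Q (T m)" for m
        unfolding T_def using A Q union.hyps(1)
        by (intro Q.finite_measure_UNION) (auto simp: disjoint_family_on_def)
      then have "(\<lambda>i. measure Q (A i)) sums (measure Q (T m) + (\<Sum>i<m. measure Q (A i)))" for m
        by (rule sums_iff_shift[THEN iffD1])
      from sums_unique2[OF s this]
      have *: "measure Q (T m) = measure Q (\<Union>i. A i) - (\<Sum>i<m. measure Q (A i))" for m
        by (simp add: algebra_simps)
      have "(\<lambda>m. measure Q (\<Union>i. A i) - (\<Sum>i<m. measure Q (A i))) \<longlonglongrightarrow>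
          measure Q (\<Union>i. A i) - measure Q (\<Union>i. A i)"
        using s unfolding sums_def by (intro tendsto_intros)
      with * show ?thesis by simp
    qed
    show ?case
    proof (rule LIMSEQ_I)
      fix e :: real assume e: "0 < e"
      \<comment> \<open>Fixed before the tail index \<open>m\<close>: it makes C / L < e / 4, and
        then \<open>m\<close> is taken so large that the factor exp (1 + L) is absorbed by the small
        mass of \<open>T m\<close> under \<open>P\<close>.\<close>
      define L where "L = 8 * (C + 1) / e"
      have L: "0 < L" "C / L < e / 4"
        using e C(2) by (auto simp: L_def field_simps intro!: add_pos_nonneg)
      have "(\<lambda>m. exp (1 + L) * measure P (T m)) \<longlonglongrightarrow> exp (1 + L) * 0"
        using tail[OF P] by (intro tendsto_intros) auto
      then have "\<forall>\<^sub>F m in sequentially. exp (1 + L) * measure P (T m) < e / 4"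
        by (rule order_tendstoD) (use e in simp)
      moreover have "\<forall>\<^sub>F m in sequentially. measure \<gamma> (T m) < e / 4"
        using tail[OF \<gamma>] e by (intro order_tendstoD) auto
      ultimately obtain m where m: "exp (1 + L) * measure P (T m) < e / 4" "measure \<gamma> (T m) < e / 4"
        using eventually_happens[OF eventually_conj] by force
      have "(\<lambda>n. \<Sum>i<m. measure (G n) (A i)) \<longlonglongrightarrow> (\<Sum>i<m. measure \<gamma> (A i))"
        by (intro tendsto_sum union.IH)
      then obtain n0 where n0: "\<And>n. n \<ge> n0 \<Longrightarrow>
          norm ((\<Sum>i<m. measure (G n) (A i)) - (\<Sum>i<m. measure \<gamma> (A i))) < e / 4"
        using LIMSEQ_D[of _ _ "e / 4"] e by force
      have "norm (measure (G n) (\<Union>i. A i) - measure \<gamma> (\<Union>i. A i)) < e" if "n \<ge> n0" for n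
      proof -
        have "measure (G n) (T m) < e / 2"
          using measure_le_rel_ent[OF P G C L(1) T, of n m] L(2) m(1) by linarith
        moreover have "measure (G n) (\<Union>i. A i) =
            (\<Sum>i<m. measure (G n) (A i)) + measure (G n) (T m)"
          "measure \<gamma> (\<Union>i. A i) = (\<Sum>i<m. measure \<gamma> (A i)) + measure \<gamma> (T m)"
          using tail[OF G] tail[OF \<gamma>] by auto
        ultimately show ?thesis
          using n0[OF that] m(2) measure_nonneg[of \<gamma> "T m"] measure_nonneg[of "G n" "T m"]
          unfolding real_norm_def by linarith
      qed
      then show "\<exists>n0. \<forall>n\<ge>n0. norm (measure (G n) (\<Union>i. A i) - measure \<gamma> (\<Union>i. A i)) < e"
        by blast
    qed
  qed
qed

section \<open>Integrals along varying measures, and lower semicontinuity of the entropy\<close>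

lemma nn_integral_layer_cake:
  assumes "sigma_finite_measure M" "g \<in> borel_measurable M"
  shows "(\<integral>\<^sup>+x. g x \<partial>M) =
    (\<integral>\<^sup>+s. (\<integral>\<^sup>+x. indicator {0..} s * indicator {x \<in> space M. ennreal s < g x} x \<partial>M) \<partial>lborel)"
proof -
  interpret M: sigma_finite_measure M by fact
  interpret pair_sigma_finite M lborel ..
  note [measurable] = assms(2)
  have "g x = (\<integral>\<^sup>+s. indicator {0..} s * indicator {x \<in> space M. ennreal s < g x} x \<partial>lborel)"
    if "x \<in> space M" for x
  proof (cases "g x")
    case (real r)
    have "(\<integral>\<^sup>+s. indicator {0..} s * indicator {x \<in> space M. ennreal s < g x} x \<partial>lborel) =
        (\<integral>\<^sup>+s. indicator {0..<r} s \<partial>lborel)"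
      using that real by (intro nn_integral_cong) (auto simp: indicator_def ennreal_less_iff)
    with real show ?thesis by simp
  next
    case top
    have "(\<integral>\<^sup>+s. indicator {0..} s * indicator {x \<in> space M. ennreal s < g x} x \<partial>lborel) =
        (\<integral>\<^sup>+s. indicator {0::real..} s \<partial>lborel)"
      using that top by (intro nn_integral_cong) (auto simp: indicator_def)
    also have "\<dots> = emeasure lborel {0::real..}"
      by (rule nn_integral_indicator) simp
    also have "\<dots> = \<infinity>"
    proof (rule ccontr)
      assume "emeasure lborel {0::real..} \<noteq> \<infinity>"
      then obtain n where "emeasure lborel {0::real..} < of_nat n"
        using ennreal_Ex_less_of_nat by (auto simp: less_top)
      also have "of_nat n = emeasure lborel {0..<real n}"
        by (subst ennreal_of_nat_eq_real_of_nat) simp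
      also have "\<dots> \<le> emeasure lborel {0::real..}"
        by (intro emeasure_mono) auto
      finally show False by simp
    qed
    finally show ?thesis using top by simp
  qed
  then have "(\<integral>\<^sup>+x. g x \<partial>M) =
      (\<integral>\<^sup>+x. (\<integral>\<^sup>+s. indicator {0..} s * indicator {x \<in> space M. ennreal s < g x} x \<partial>lborel) \<partial>M)"
    by (rule nn_integral_cong)
  also have "\<dots> = (\<integral>\<^sup>+s. (\<integral>\<^sup>+x. indicator {0..} s * indicator {x \<in> space M. ennreal s < g x} x \<partial>M) \<partial>lborel)"
    by (rule Fubini'[symmetric]) measurable
  finally show ?thesis .
qed

text \<open>Only superlevel sets of the one function \<open>g\<close> are tested. This serves both
  the pair cost, whose superlevel sets are open, and the entropy, where the measures converge on all
  measurable sets.\<close>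

lemma nn_integral_le_liminf:
  fixes G :: "nat \<Rightarrow> 'b measure"
  assumes G: "\<And>n. prob_space (G n)" "\<And>n. sets (G n) = sets \<gamma>" and \<gamma>: "prob_space \<gamma>"
    and g[measurable]: "g \<in> borel_measurable \<gamma>"
    and le: "\<And>s. 0 \<le> s \<Longrightarrow> emeasure \<gamma> {x \<in> space \<gamma>. ennreal s < g x} \<le>
        liminf (\<lambda>n. emeasure (G n) {x \<in> space \<gamma>. ennreal s < g x})"
  shows "(\<integral>\<^sup>+x. g x \<partial>\<gamma>) \<le> liminf (\<lambda>n. \<integral>\<^sup>+x. g x \<partial>G n)"
proof -
  interpret \<gamma>: prob_space \<gamma> by fact
  have sp: "space (G n) = space \<gamma>" for n
    using G(2) by (rule sets_eq_imp_space_eq)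
  let ?I = "\<lambda>s x. indicator {0..} s * indicator {x \<in> space \<gamma>. ennreal s < g x} x :: ennreal"
  have ev: "(\<integral>\<^sup>+x. ?I s x \<partial>Q) = indicator {0..} s * emeasure Q {x \<in> space \<gamma>. ennreal s < g x}"
    if "sets Q = sets \<gamma>" for Q s
    using that by (subst nn_integral_cmult) (auto cong: measurable_cong_sets)
  have gG: "g \<in> borel_measurable (G n)" for n
    using g measurable_cong_sets[OF G(2) refl] by blast
  have cake: "(\<integral>\<^sup>+x. g x \<partial>G n) = (\<integral>\<^sup>+s. (\<integral>\<^sup>+x. ?I s x \<partial>G n) \<partial>lborel)" for n
    unfolding sp[of n, symmetric]
    using G(1) gG by (intro nn_integral_layer_cake prob_space_imp_sigma_finite)
  have meas: "(\<lambda>s. \<integral>\<^sup>+x. ?I s x \<partial>G n) \<in> borel_measurable lborel" for n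
  proof -
    interpret Gn: prob_space "G n" by fact
    note [measurable] = gG
    show ?thesis
      unfolding sp[of n, symmetric] by measurable
  qed
  have "(\<integral>\<^sup>+x. g x \<partial>\<gamma>) = (\<integral>\<^sup>+s. (\<integral>\<^sup>+x. ?I s x \<partial>\<gamma>) \<partial>lborel)"
    by (rule nn_integral_layer_cake[OF \<gamma>.sigma_finite_measure_axioms g])
  also have "\<dots> \<le> (\<integral>\<^sup>+s. liminf (\<lambda>n. \<integral>\<^sup>+x. ?I s x \<partial>G n) \<partial>lborel)"
    unfolding ev[OF refl] ev[OF G(2)]
    using le by (intro nn_integral_mono) (auto split: split_indicator)
  also have "\<dots> \<le> liminf (\<lambda>n. \<integral>\<^sup>+s. (\<integral>\<^sup>+x. ?I s x \<partial>G n) \<partial>lborel)"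
    by (rule nn_integral_liminf[OF meas])
  also have "\<dots> = liminf (\<lambda>n. \<integral>\<^sup>+x. g x \<partial>G n)"
    unfolding cake ..
  finally show ?thesis .
qed

text \<open>With \<open>h n\<close> the density of \<open>G n\<close> and \<open>s k\<close> a fixed
  positive function, the tangent inequality bounds the entropy of \<open>G n\<close> below by the
  integral of h ln s - s + 1. This is affine in \<open>h n\<close> with bounded coefficient ln s, so
  setwise convergence lets \<open>n\<close> tend to infinity. Fatou's lemma then removes the
  truncation in \<open>s k\<close>.\<close>

lemma rel_ent_lsc:
  fixes G :: "nat \<Rightarrow> 'b measure"
  assumes P: "prob_space P" and G: "\<And>n. prob_space (G n)" "\<And>n. sets (G n) = sets P"
    and \<gamma>: "prob_space \<gamma>" "sets \<gamma> = sets P"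
    and C: "\<And>n. rel_ent P (G n) \<le> ennreal C" "0 \<le> C"
    and E: "Int_stable E" "E \<subseteq> Pow (space P)" "sets P = sigma_sets (space P) E"
    and conv: "\<And>A. A \<in> E \<Longrightarrow> (\<lambda>n. measure (G n) A) \<longlonglongrightarrow> measure \<gamma> A"
  shows "rel_ent P \<gamma> \<le> liminf (\<lambda>n. rel_ent P (G n))"
proof -
  interpret P: prob_space P by fact
  interpret \<gamma>: prob_space \<gamma> by fact
  have sw: "(\<lambda>n. measure (G n) A) \<longlonglongrightarrow> measure \<gamma> A" if "A \<in> sets P" for A
    by (rule setwise_convergence[OF P G \<gamma> C E conv that])
  have fin: "rel_ent P (G n) < \<infinity>" for n
    using C(1)[of n] by (auto intro: le_less_trans)
  have "\<forall>n. \<exists>h. h \<in> borel_measurable P \<and> (\<forall>x. 0 \<le> h x) \<and>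
      G n = density P (\<lambda>x. ennreal (h x)) \<and> rel_ent P (G n) = (\<integral>\<^sup>+x. ent_fn (h x) \<partial>P)"
    using finite_rel_ent_density[OF P.sigma_finite_measure_axioms G fin] by metis
  then obtain h where h[measurable]: "\<And>n. h n \<in> borel_measurable P" and h0: "\<And>n x. 0 \<le> h n x"
    and Gh: "\<And>n. G n = density P (\<lambda>x. ennreal (h n x))"
    and Rh: "\<And>n. rel_ent P (G n) = (\<integral>\<^sup>+x. ent_fn (h n x) \<partial>P)"
    by metis
  have "absolutely_continuous P \<gamma>"
    unfolding absolutely_continuous_def
  proof
    fix A assume A: "A \<in> null_sets P"
    have "measure (G n) A = 0" for n
    proof -
      have "A \<in> null_sets (G n)"
        using A absolutely_continuousI_density[of "\<lambda>x. ennreal (h n x)" P]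
        unfolding Gh absolutely_continuous_def by auto
      then show ?thesis by (simp add: measure_def null_sets_def)
    qed
    with sw[of A] A have "measure \<gamma> A = 0"
      by (simp add: LIMSEQ_const_iff null_sets_def)
    with A \<gamma>(2) show "A \<in> null_sets \<gamma>"
      by (simp add: null_sets_def \<gamma>.emeasure_eq_measure)
  qed
  then obtain g :: "'b \<Rightarrow> real" where g[measurable]: "g \<in> borel_measurable P" and g0: "\<And>x. 0 \<le> g x"
    and \<gamma>g: "\<gamma> = density P (\<lambda>x. ennreal (g x))"
    using real_density_exists[OF P.sigma_finite_measure_axioms \<gamma>] by metis
  \<comment> \<open>The limiting density cut off at 1/(k+1) and k+1, so that its logarithm is
    bounded.\<close>
  define s where "s k x = max (1 / real (Suc k)) (min (g x) (real (Suc k)))" for k x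
  have s[measurable]: "s k \<in> borel_measurable P" for k
    unfolding s_def[abs_def] by measurable
  have s_pos: "0 < s k x" for k x
    unfolding s_def by (intro less_max_iff_disj[THEN iffD2] disjI1) simp
  have s_le: "s k x \<le> real (Suc k)" for k x
    using order_trans[of "1 / real (Suc k)" 1 "real (Suc k)"] by (simp add: s_def)
  have s_ln: "0 \<le> ln (s k x) + ln (real (Suc k))" for k x
  proof -
    have "1 / real (Suc k) \<le> s k x" by (simp add: s_def)
    then have "ln (1 / real (Suc k)) \<le> ln (s k x)" by (rule ln_mono) simp
    then show ?thesis by (simp add: ln_div)
  qed
  define q where "q k x = g x * ln (s k x) - s k x + 1" for k x
  have q[measurable]: "q k \<in> borel_measurable P" for k
    unfolding q_def[abs_def] by measurable
  \<comment> \<open>Here q = \<open>ent_fn s\<close> + (g - s) ln s. Where the cutoff is active, g -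
    s and ln s have the same sign: g lies below s = 1/(k+1) \<le> 1, or above s = k+1 \<ge>
    1.\<close>
  have q0: "0 \<le> q k x" for k x
  proof -
    consider "g x < 1 / real (Suc k)" | "1 / real (Suc k) \<le> g x" "g x \<le> real (Suc k)" | "real (Suc k) < g x"
      by linarith
    then have "s k x * ln (s k x) \<le> g x * ln (s k x)"
    proof cases
      case 1
      then have "s k x = 1 / real (Suc k)" by (auto simp: s_def)
      with 1 show ?thesis by (intro mult_right_mono_neg) (auto simp: ln_div)
    next
      case 2
      then have "s k x = g x" by (auto simp: s_def)
      then show ?thesis by simp
    next
      case 3
      then have "s k x = real (Suc k)"
        using order_trans[of "1 / real (Suc k)" 1 "real (Suc k)"] by (simp add: s_def)
      with 3 show ?thesis by (intro mult_right_mono) auto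
    qed
    moreover have "0 \<le> ent_fn (s k x)"
      using s_pos[of k x] by (intro ent_fn_nonneg) simp
    ultimately show ?thesis by (simp add: q_def ent_fn_def)
  qed
  have q_le: "(\<integral>\<^sup>+x. q k x \<partial>P) \<le> liminf (\<lambda>n. rel_ent P (G n))" for k
  proof -
    \<comment> \<open>Adding ln (k+1) makes the coefficient nonnegative. The compensation
      \<open>D\<close>, this shift plus the integral of \<open>s k\<close>, is finite and the same
      for every probability density, so it cancels at the end.\<close>
    define a where "a x = ln (s k x) + ln (real (Suc k))" for x
    have a[measurable]: "a \<in> borel_measurable P"
      unfolding a_def[abs_def] by measurable
    have a0: "0 \<le> a x" for x using s_ln by (simp add: a_def)
    define D where "D = ennreal (ln (real (Suc k))) + (\<integral>\<^sup>+x. s k x \<partial>P)"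
    have "(\<integral>\<^sup>+x. s k x \<partial>P) \<le> (\<integral>\<^sup>+x. ennreal (real (Suc k)) \<partial>P)"
      by (intro nn_integral_mono ennreal_leI s_le)
    then have Dfin: "D \<noteq> \<infinity>"
      by (auto simp: D_def P.emeasure_space_1 top_unique)
    have mass: "(\<integral>\<^sup>+x. ennreal (u x * a x + 1) \<partial>P) = (\<integral>\<^sup>+x. a x \<partial>Q) + 1"
      "(\<integral>\<^sup>+x. ennreal (u x * ln (real (Suc k)) + s k x) \<partial>P) = D"
      if u[measurable]: "u \<in> borel_measurable P" and u0: "\<And>x. 0 \<le> u x"
        and Qu: "Q = density P (\<lambda>x. ennreal (u x))" and Q: "prob_space Q" for u Q
    proof -
      have 1: "(\<integral>\<^sup>+x. ennreal (u x) \<partial>P) = 1"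
        using prob_space.emeasure_space_1[OF Q] unfolding Qu
        by (simp add: emeasure_density cong: nn_integral_cong)
      have "(\<integral>\<^sup>+x. ennreal (u x * a x + 1) \<partial>P) = (\<integral>\<^sup>+x. ennreal (u x) * ennreal (a x) + 1 \<partial>P)"
        using u0 a0 by (intro nn_integral_cong) (simp add: ennreal_mult)
      also have "\<dots> = (\<integral>\<^sup>+x. a x \<partial>Q) + 1"
        unfolding Qu by (subst nn_integral_add) (auto simp: nn_integral_density P.emeasure_space_1)
      finally show "(\<integral>\<^sup>+x. ennreal (u x * a x + 1) \<partial>P) = (\<integral>\<^sup>+x. a x \<partial>Q) + 1" .
      have "(\<integral>\<^sup>+x. ennreal (u x * ln (real (Suc k)) + s k x) \<partial>P) =
          (\<integral>\<^sup>+x. ennreal (ln (real (Suc k))) * ennreal (u x) + ennreal (s k x) \<partial>P)"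
        using u0 s_pos[of k, THEN less_imp_le]
        by (intro nn_integral_cong) (simp add: ennreal_mult mult.commute)
      also have "\<dots> = D"
        unfolding D_def by (subst nn_integral_add) (auto simp: nn_integral_cmult 1)
      finally show "(\<integral>\<^sup>+x. ennreal (u x * ln (real (Suc k)) + s k x) \<partial>P) = D" .
    qed
    have up: "(\<integral>\<^sup>+x. a x \<partial>G n) + 1 \<le> rel_ent P (G n) + D" for n
    proof -
      have "(\<integral>\<^sup>+x. a x \<partial>G n) + 1 = (\<integral>\<^sup>+x. ennreal (h n x * a x + 1) \<partial>P)"
        using mass(1)[OF h h0 Gh G(1)] by simp
      also have "\<dots> \<le> (\<integral>\<^sup>+x. ennreal (ent_fn (h n x)) + ennreal (h n x * ln (real (Suc k)) + s k x) \<partial>P)"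
      proof (rule nn_integral_mono)
        fix x
        have "h n x * a x + 1 \<le> ent_fn (h n x) + (h n x * ln (real (Suc k)) + s k x)"
          using ent_fn_tangent[OF h0 s_pos, of n x k x] by (simp add: a_def algebra_simps)
        then have "ennreal (h n x * a x + 1) \<le>
            ennreal (ent_fn (h n x) + (h n x * ln (real (Suc k)) + s k x))"
          by (rule ennreal_leI)
        also have "\<dots> = ennreal (ent_fn (h n x)) + ennreal (h n x * ln (real (Suc k)) + s k x)"
          using ent_fn_nonneg[OF h0] h0 s_pos[of k x] by (intro ennreal_plus) auto
        finally show "ennreal (h n x * a x + 1) \<le> \<dots>" .
      qed
      also have "\<dots> = rel_ent P (G n) + D"
        unfolding Rh mass(2)[OF h[of n] h0 Gh G(1), symmetric]
        by (rule nn_integral_add) auto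
      finally show ?thesis .
    qed
    have "(\<integral>\<^sup>+x. q k x \<partial>P) + D = (\<integral>\<^sup>+x. ennreal (q k x) + ennreal (g x * ln (real (Suc k)) + s k x) \<partial>P)"
      unfolding mass(2)[OF g g0 \<gamma>g \<gamma>(1), symmetric]
      by (rule nn_integral_add[symmetric]) auto
    also have "\<dots> = (\<integral>\<^sup>+x. ennreal (g x * a x + 1) \<partial>P)"
    proof (rule nn_integral_cong)
      fix x
      have "ennreal (q k x) + ennreal (g x * ln (real (Suc k)) + s k x) =
          ennreal (q k x + (g x * ln (real (Suc k)) + s k x))"
        using q0[of k x] g0 s_pos[of k x] by (intro ennreal_plus[symmetric]) auto
      also have "q k x + (g x * ln (real (Suc k)) + s k x) = g x * a x + 1"
        by (simp add: q_def a_def algebra_simps)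
      finally show "ennreal (q k x) + ennreal (g x * ln (real (Suc k)) + s k x) =
          ennreal (g x * a x + 1)" .
    qed
    also have "\<dots> = (\<integral>\<^sup>+x. a x \<partial>\<gamma>) + 1"
      by (rule mass(1)[OF g g0 \<gamma>g \<gamma>(1)])
    also have "\<dots> \<le> liminf (\<lambda>n. \<integral>\<^sup>+x. a x \<partial>G n) + 1"
    proof (intro add_right_mono nn_integral_le_liminf)
      fix t :: real
      let ?A = "{x \<in> space \<gamma>. ennreal t < ennreal (a x)}"
      have "?A \<in> sets P"
        unfolding sets_eq_imp_space_eq[OF \<gamma>(2)] by measurable
      then have "(\<lambda>n. ennreal (measure (G n) ?A)) \<longlonglongrightarrow> ennreal (measure \<gamma> ?A)"
        by (intro tendsto_ennrealI sw)
      then have "(\<lambda>n. emeasure (G n) ?A) \<longlonglongrightarrow> emeasure \<gamma> ?A"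
        using G(1) by (simp add: \<gamma>.emeasure_eq_measure
            finite_measure.emeasure_eq_measure[OF prob_space.finite_measure])
      then show "emeasure \<gamma> ?A \<le> liminf (\<lambda>n. emeasure (G n) ?A)"
        by (simp add: lim_imp_Liminf)
    qed (use G \<gamma> a measurable_cong_sets[OF \<gamma>(2) refl] in auto)
    also have "\<dots> = liminf (\<lambda>n. (\<integral>\<^sup>+x. a x \<partial>G n) + 1)"
      by (rule Liminf_add_const[symmetric]) simp
    also have "\<dots> \<le> liminf (\<lambda>n. rel_ent P (G n) + D)"
      by (intro Liminf_mono always_eventually allI up)
    also have "\<dots> = liminf (\<lambda>n. rel_ent P (G n)) + D"
      by (rule Liminf_add_const) simp
    finally show ?thesis
      using Dfin by (simp add: add.commute[of _ D] ennreal_add_left_cancel_le)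
  qed
  \<comment> \<open>Where g > 0 the truncation is eventually inactive; where g = 0 the value is 1 -
    1/(k+1), tending to \<open>ent_fn 0\<close> = 1.\<close>
  have lim: "(\<lambda>k. ennreal (q k x)) \<longlonglongrightarrow> ennreal (ent_fn (g x))" for x
  proof (cases "g x = 0")
    case True
    have "(\<lambda>k. 1 - 1 / real (Suc k)) \<longlonglongrightarrow> 1 - 0"
      by (intro tendsto_diff tendsto_const) (use LIMSEQ_inverse_real_of_nat in \<open>simp add: inverse_eq_divide\<close>)
    moreover have "q k x = 1 - 1 / real (Suc k)" for k
      using True by (simp add: q_def s_def)
    ultimately show ?thesis
      using True by (intro tendsto_ennrealI) (simp add: ent_fn_def)
  next
    case False
    then have "0 < g x" using g0[of x] by simp
    then obtain k0 where k0: "1 / real (Suc k0) < g x"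
      using reals_Archimedean[of "g x"] by (auto simp: inverse_eq_divide)
    obtain k1 where k1: "g x < real k1"
      using reals_Archimedean2 by blast
    have "q k x = ent_fn (g x)" if "k \<ge> max k0 k1" for k
    proof -
      have "1 / real (Suc k) \<le> 1 / real (Suc k0)"
        using that by (intro divide_left_mono) auto
      then have "s k x = g x"
        using k0 k1 that by (auto simp: s_def)
      then show ?thesis by (simp add: q_def ent_fn_def)
    qed
    then have "\<forall>\<^sub>F k in sequentially. ennreal (q k x) = ennreal (ent_fn (g x))"
      unfolding eventually_sequentially by metis
    then show ?thesis
      by (rule tendsto_eventually)
  qed
  have "rel_ent P \<gamma> = (\<integral>\<^sup>+x. liminf (\<lambda>k. ennreal (q k x)) \<partial>P)"
    unfolding \<gamma>g rel_ent_density[OF P.sigma_finite_measure_axioms g g0]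
    by (intro nn_integral_cong lim_imp_Liminf[OF _ lim, symmetric]) simp
  also have "\<dots> \<le> liminf (\<lambda>k. \<integral>\<^sup>+x. q k x \<partial>P)"
    by (rule nn_integral_liminf) simp
  also have "\<dots> \<le> liminf (\<lambda>k::nat. liminf (\<lambda>n. rel_ent P (G n)))"
    by (intro Liminf_mono always_eventually allI q_le)
  finally show ?thesis
    by (simp add: Liminf_const)
qed

section \<open>Lower semicontinuity of the cost\<close>

locale repulsive =
  fixes f :: "real \<Rightarrow> ereal"
  assumes f0: "f 0 = \<infinity>" and F1: "cond_F1 f" and F2: "cond_F2 f"
begin

lemma f_not_MInf:
  assumes "0 \<le> t"
  shows "f t \<noteq> -\<infinity>"
proof (cases "t = 0")
  case False
  with assms have "\<bar>f t\<bar> \<noteq> \<infinity>"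
    using F1 unfolding cond_F1_def by simp
  then show ?thesis by auto
qed (simp add: f0)

lemma f_antimono: "0 < s \<Longrightarrow> s \<le> t \<Longrightarrow> f t \<le> f s"
  using F1 monotone_onD[of "{0<..}" "(\<le>)" "\<lambda>x y. y \<le> x" f s t] unfolding cond_F1_def by simp

text \<open>Condition (F2) together with f 0 = \<infinity> is exactly continuity at 0 in the
  extended reals. It makes the pair cost continuous across the diagonal as well.\<close>

lemma f_continuous: "continuous_on {0..} f"
  unfolding continuous_on_def
proof
  fix t :: real assume t: "t \<in> {0..}"
  show "(f \<longlongrightarrow> f t) (at t within {0..})"
  proof (cases "t = 0")
    case True
    have "at (0::real) within {0..} = at_right 0"
    proof -
      have "{0::real..} - {0} = {0<..} - {0}" by auto
      then show ?thesis by (simp only: at_within_def)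
    qed
    then show ?thesis
      using F2 f0 True unfolding cond_F2_def by simp
  next
    case False
    with t have "0 < t" by simp
    then have "isCont f t"
      using F1 unfolding cond_F1_def by (simp add: continuous_on_eq_continuous_at)
    then have "(f \<longlongrightarrow> f t) (at t)"
      by (simp add: isCont_def)
    then show ?thesis
      by (rule tendsto_within_subset) simp
  qed
qed

lemma f_dist_continuous:
  assumes "continuous_on UNIV d" "\<And>p. 0 \<le> d p"
  shows "continuous_on UNIV (\<lambda>p. f (d p))"
  by (rule continuous_on_compose2[OF f_continuous assms(1)]) (use assms(2) in auto)

text \<open>Since \<open>d(x,y) \<le> 2 max {d(x,z), d(y,z)}\<close>, adding \<open>tail z x + tail z y\<close> makes \<open>f (d(x,y))\<close> nonnegative.\<close>

definition tail :: "'a::polish_space \<Rightarrow> 'a \<Rightarrow> real" where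
  "tail z x = real_of_ereal (max 0 (- f (2 * dist x z)))"

lemma tail_nonneg: "0 \<le> tail z x"
  by (simp add: tail_def real_of_ereal_pos)

text \<open>The conversion to a real number loses nothing: the maximum with 0 removes the value
  -\<infinity> at x = z, and \<open>f\<close> never takes -\<infinity> on nonnegative
  arguments.\<close>

lemma ereal_tail: "ereal (tail z x) = max 0 (- f (2 * dist x z))"
  unfolding tail_def using f_not_MInf[of "2 * dist x z"]
  by (intro ereal_real') (cases "f (2 * dist x z)", auto simp: max_def)

lemma tail_continuous: "continuous_on UNIV (tail z)"
  unfolding continuous_on_def tail_def
proof
  fix x
  have "continuous_on UNIV (\<lambda>x. max 0 (- f (2 * dist x z)))"
  proof (intro continuous_on_max continuous_on_const)
    have "continuous_on UNIV (\<lambda>x. f (2 * dist x z))"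
      by (intro f_dist_continuous continuous_intros) auto
    then show "continuous_on UNIV (\<lambda>x. - f (2 * dist x z))"
      by (auto simp: continuous_on_def intro!: tendsto_uminus_ereal)
  qed
  then have "((\<lambda>x. max 0 (- f (2 * dist x z))) \<longlongrightarrow> ereal (tail z x)) (at x)"
    by (simp add: continuous_on_def ereal_tail)
  then have "((\<lambda>x. real_of_ereal (max 0 (- f (2 * dist x z)))) \<longlongrightarrow> tail z x) (at x)"
    by (rule lim_real_of_ereal)
  then show "((\<lambda>x. real_of_ereal (max 0 (- f (2 * dist x z)))) \<longlongrightarrow>
      real_of_ereal (max 0 (- f (2 * dist x z)))) (at x)"
    unfolding tail_def .
qed

lemma tail_measurable [measurable]: "tail z \<in> borel_measurable borel"
  by (intro borel_measurable_continuous_onI tail_continuous)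

lemma f_plus_tail_nonneg: "0 \<le> f (dist x y) + ereal (tail z x + tail z y)"
proof (cases "x = y")
  case True
  then show ?thesis by (simp add: f0)
next
  case False
  then have d: "0 < dist x y" by simp
  have tri: "dist x y \<le> dist x z + dist y z"
    by (metis dist_commute dist_triangle)
  \<comment> \<open>The tail at \<open>w\<close>, the point farther from \<open>z\<close>, does all
    the work; \<open>u\<close> stands for the other tail, of which only the sign matters.\<close>
  have key: "0 \<le> f (dist x y) + ereal (tail z w + u)" if "dist x y \<le> 2 * dist w z" "0 \<le> u" for w u
  proof -
    have "- f (dist x y) \<le> - f (2 * dist w z)"
      using f_antimono[OF d that(1)] by simp
    also have "\<dots> \<le> ereal (tail z w)" by (simp add: ereal_tail)
    also have "\<dots> \<le> ereal (tail z w + u)" using that(2) by simp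
    finally show ?thesis
      by (cases "f (dist x y)") auto
  qed
  show ?thesis
    using tri key[of x "tail z y"] key[of y "tail z x"] tail_nonneg[of z]
    by (cases "dist y z \<le> dist x z") (simp_all add: add.commute)
qed

definition pair_cost :: "'a::polish_space \<Rightarrow> 'a \<times> 'a \<Rightarrow> ennreal" where
  "pair_cost z p = e2ennreal (f (dist (fst p) (snd p)) + ereal (tail z (fst p) + tail z (snd p)))"

lemma enn2ereal_pair_cost:
  "enn2ereal (pair_cost z (x, y)) = f (dist x y) + ereal (tail z x + tail z y)"
  unfolding pair_cost_def fst_conv snd_conv by (rule enn2ereal_e2ennreal[OF f_plus_tail_nonneg])

text \<open>With the finite tails moved to the other side, the set is given by a strict inequality
  between two continuous extended-real functions.\<close>

lemma pair_cost_open: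
  assumes "0 \<le> s"
  shows "open {p :: 'a::polish_space \<times> 'a. ennreal s < pair_cost z p}"
proof -
  have tc: "continuous_on UNIV (\<lambda>p. tail z (g p))" if "continuous_on UNIV g" for g :: "'a \<times> 'a \<Rightarrow> 'a"
    by (rule continuous_on_compose2[OF tail_continuous that]) simp
  have "ennreal s < pair_cost z p \<longleftrightarrow>
      ereal (s - tail z (fst p) - tail z (snd p)) < f (dist (fst p) (snd p))" for p
  proof -
    obtain x y where p: "p = (x, y)" by (cases p)
    have "ennreal s < pair_cost z p \<longleftrightarrow> ereal s < f (dist x y) + ereal (tail z x + tail z y)"
      using assms by (simp add: less_ennreal.rep_eq enn2ereal_pair_cost p max_absorb2)
    also have "\<dots> \<longleftrightarrow> ereal (s - tail z x - tail z y) < f (dist x y)"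
      by (cases "f (dist x y)") auto
    finally show ?thesis by (simp add: p)
  qed
  moreover have "open {p :: 'a \<times> 'a. ereal (s - tail z (fst p) - tail z (snd p)) < f (dist (fst p) (snd p))}"
    by (intro open_Collect_less continuous_on_ereal f_dist_continuous continuous_on_diff tc
        continuous_intros) auto
  ultimately show ?thesis by simp
qed

lemma pair_cost_measurable [measurable]: "pair_cost z \<in> borel_measurable borel"
proof -
  have "(\<lambda>p::'a \<times> 'a. f (dist (fst p) (snd p))) \<in> borel_measurable borel"
    by (intro borel_measurable_continuous_onI f_dist_continuous continuous_intros) auto
  moreover have "(\<lambda>p::'a \<times> 'a. tail z (fst p) + tail z (snd p)) \<in> borel_measurable borel"
    unfolding borel_prod[symmetric] by measurable
  ultimately show ?thesis
    unfolding pair_cost_def[abs_def] by measurable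
qed

definition shifted_cost :: "nat \<Rightarrow> 'a::polish_space \<Rightarrow> (nat \<Rightarrow> 'a) \<Rightarrow> ennreal" where
  "shifted_cost N z x = (\<Sum>i<N. \<Sum>j\<in>{i<..<N}. pair_cost z (x i, x j))"

definition tail_sum :: "nat \<Rightarrow> 'a::polish_space \<Rightarrow> (nat \<Rightarrow> 'a) \<Rightarrow> real" where
  "tail_sum N z x = (\<Sum>i<N. \<Sum>j\<in>{i<..<N}. tail z (x i) + tail z (x j))"

lemma cost_eq: "cost N f x = enn2ereal (shifted_cost N z x) + ereal (- tail_sum N z x)"
proof -
  have "f (dist a b) = enn2ereal (pair_cost z (a, b)) + ereal (- (tail z a + tail z b))" for a b
    unfolding enn2ereal_pair_cost by (cases "f (dist a b)") auto
  then show ?thesis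
    unfolding cost_def shifted_cost_def tail_sum_def
    by (simp only: sum.distrib sum_ereal sum_negf sum_enn2ereal zero_le)
qed

lemma pair_measurable:
  assumes "sets \<gamma> = sets (borel_N N :: (nat \<Rightarrow> 'a::polish_space) measure)" "i < N" "j < N"
  shows "(\<lambda>x. pair_cost z (x i, x j)) \<in> borel_measurable \<gamma>"
proof -
  have "(\<lambda>x. (x i, x j)) \<in> measurable \<gamma> (borel \<Otimes>\<^sub>M borel)"
    using component_measurable[OF assms(1)] assms by (intro measurable_Pair) auto
  then show ?thesis
    unfolding borel_prod by (rule measurable_compose) (rule pair_cost_measurable)
qed

lemma shifted_cost_measurable:
  assumes "sets \<gamma> = sets (borel_N N)"
  shows "shifted_cost N z \<in> borel_measurable \<gamma>"
  unfolding shifted_cost_def[abs_def] using pair_measurable[OF assms]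
  by (intro borel_measurable_sum) auto

lemma shifted_cost_lsc:
  assumes "base_sequence U" and conv: "base_sequence.box_conv U N G \<gamma>"
    and G: "\<And>n. prob_space (G n)" "\<And>n. sets (G n) = sets (borel_N N)"
    and \<gamma>: "prob_space \<gamma>" "sets \<gamma> = sets (borel_N N)"
  shows "(\<integral>\<^sup>+x. shifted_cost N z x \<partial>\<gamma>) \<le> liminf (\<lambda>n. \<integral>\<^sup>+x. shifted_cost N z x \<partial>G n)"
proof -
  interpret base_sequence U by fact
  have split: "(\<integral>\<^sup>+x. shifted_cost N z x \<partial>Q) =
      (\<Sum>i<N. \<Sum>j\<in>{i<..<N}. \<integral>\<^sup>+x. pair_cost z (x i, x j) \<partial>Q)"
    if "sets Q = sets (borel_N N)" for Q
    unfolding shifted_cost_def using pair_measurable[OF that]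
    by (subst nn_integral_sum) (auto intro!: borel_measurable_sum sum.cong nn_integral_sum)
  have "(\<integral>\<^sup>+x. pair_cost z (x i, x j) \<partial>\<gamma>) \<le> liminf (\<lambda>n. \<integral>\<^sup>+x. pair_cost z (x i, x j) \<partial>G n)"
    if ij: "i < N" "j < N" for i j
  proof (rule nn_integral_le_liminf)
    fix s :: real assume "0 \<le> s"
    then show "emeasure \<gamma> {x \<in> space \<gamma>. ennreal s < pair_cost z (x i, x j)} \<le>
        liminf (\<lambda>n. emeasure (G n) {x \<in> space \<gamma>. ennreal s < pair_cost z (x i, x j)})"
      using box_conv_open_pair[OF conv G \<gamma> ij pair_cost_open, of s z]
      by (simp add: sets_eq_imp_space_eq[OF \<gamma>(2)])
  qed (use G \<gamma> pair_measurable ij in auto)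
  then have "(\<integral>\<^sup>+x. shifted_cost N z x \<partial>\<gamma>) \<le>
      (\<Sum>i<N. \<Sum>j\<in>{i<..<N}. liminf (\<lambda>n. \<integral>\<^sup>+x. pair_cost z (x i, x j) \<partial>G n))"
    unfolding split[OF \<gamma>(2)] by (intro sum_mono) auto
  also have "\<dots> \<le> (\<Sum>i<N. liminf (\<lambda>n. \<Sum>j\<in>{i<..<N}. \<integral>\<^sup>+x. pair_cost z (x i, x j) \<partial>G n))"
    by (intro sum_mono sum_liminf_le) auto
  also have "\<dots> \<le> liminf (\<lambda>n. \<Sum>i<N. \<Sum>j\<in>{i<..<N}. \<integral>\<^sup>+x. pair_cost z (x i, x j) \<partial>G n)"
    by (intro sum_liminf_le) auto
  finally show ?thesis
    unfolding split[OF G(2)] .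
qed

text \<open>Outside the ball the tail is the negative part of the integrand in (B); inside,
  monotonicity gives f (2 d(x,z)) \<ge> f (2 r0), so the tail is bounded by the absolute value of f
  (2 r0).\<close>

lemma tail_integrable:
  fixes \<mu> :: "'a::polish_space measure"
  assumes \<mu>: "prob_space \<mu>" "sets \<mu> = sets borel" and "cond_B f \<mu>"
  obtains z where "integrable \<mu> (tail z)"
proof -
  interpret prob_space \<mu> by fact
  obtain z r0 where r0: "0 < r0"
    and B: "ext_integral \<mu> (\<lambda>x. indicator (- ball z r0) x * f (2 * dist x z)) > -\<infinity>"
    using assms(3) unfolding cond_B_def by blast
  define h where "h x = indicator (- ball z r0) x * f (2 * dist x z)" for x
  have far: "f (2 * dist x z) \<le> f (2 * r0)" if "x \<notin> ball z r0" for x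
    using that r0 by (intro f_antimono) (auto simp: dist_commute)
  have fin: "\<bar>f (2 * r0)\<bar> \<noteq> \<infinity>"
    using F1 r0 unfolding cond_F1_def by simp
  then obtain c where c: "f (2 * r0) = ereal c" by auto
  \<comment> \<open>The positive part comes first: by the convention \<infinity> - \<infinity> =
    \<infinity>, \<open>cond_B\<close> yields a finite negative part only once the positive part is
    known to be finite.\<close>
  have "(\<integral>\<^sup>+x. e2ennreal (h x) \<partial>\<mu>) \<le> (\<integral>\<^sup>+x. ennreal \<bar>c\<bar> \<partial>\<mu>)"
  proof (rule nn_integral_mono)
    fix x
    have "h x \<le> ereal \<bar>c\<bar>"
      using far[of x] c by (cases "x \<in> ball z r0") (auto simp: h_def intro: order_trans)
    then show "e2ennreal (h x) \<le> ennreal \<bar>c\<bar>"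
      by (metis e2ennreal_ereal e2ennreal_mono)
  qed
  then have pos: "(\<integral>\<^sup>+x. e2ennreal (h x) \<partial>\<mu>) \<noteq> \<infinity>"
    by (auto simp: emeasure_space_1 top_unique)
  then have neg: "(\<integral>\<^sup>+x. e2ennreal (- h x) \<partial>\<mu>) \<noteq> \<infinity>"
    using B unfolding ext_integral_def h_def[symmetric] by (cases "\<integral>\<^sup>+x. e2ennreal (h x) \<partial>\<mu>") auto
  have m: "(\<lambda>x. f (2 * dist x z)) \<in> borel_measurable \<mu>"
  proof -
    have "(\<lambda>x. f (2 * dist x z)) \<in> borel_measurable borel"
      by (intro borel_measurable_continuous_onI f_dist_continuous continuous_intros) auto
    then show ?thesis using measurable_cong_sets[OF \<mu>(2) refl] by blast
  qed
  have tm: "tail z \<in> borel_measurable \<mu>"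
    using tail_measurable measurable_cong_sets[OF \<mu>(2) refl] by blast
  have hm: "h \<in> borel_measurable \<mu>"
    unfolding h_def[abs_def] using m \<mu>(2)
    by (intro borel_measurable_ereal_times borel_measurable_indicator) auto
  have "integrable \<mu> (tail z)"
  proof (rule integrableI_nonneg)
    have "(\<integral>\<^sup>+x. ennreal (tail z x) \<partial>\<mu>) \<le> (\<integral>\<^sup>+x. e2ennreal (- h x) + ennreal \<bar>c\<bar> \<partial>\<mu>)"
    proof (rule nn_integral_mono)
      fix x
      have et: "ennreal (tail z x) = e2ennreal (max 0 (- f (2 * dist x z)))"
        by (simp add: ereal_tail[symmetric])
      show "ennreal (tail z x) \<le> e2ennreal (- h x) + ennreal \<bar>c\<bar>"
      proof (cases "x \<in> ball z r0")
        case True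
        have "- f (2 * dist x z) \<le> ereal \<bar>c\<bar>"
        proof (cases "x = z")
          case True
          then show ?thesis by (simp add: f0)
        next
          case False
          then have "f (2 * r0) \<le> f (2 * dist x z)"
            using \<open>x \<in> ball z r0\<close> by (intro f_antimono) (auto simp: dist_commute)
          then show ?thesis
            using c by (cases "f (2 * dist x z)") auto
        qed
        then have "ennreal (tail z x) \<le> e2ennreal (ereal \<bar>c\<bar>)"
          unfolding et by (intro e2ennreal_mono) simp
        then show ?thesis by (simp add: add_increasing)
      next
        case False
        then have "h x = f (2 * dist x z)" by (simp add: h_def)
        then have "ennreal (tail z x) = e2ennreal (- h x)"
          unfolding et by (cases "h x") (auto simp: max_def e2ennreal_neg)
        then show ?thesis by (simp add: add_increasing2)
      qed
    qed
    also have "\<dots> = (\<integral>\<^sup>+x. e2ennreal (- h x) \<partial>\<mu>) + ennreal \<bar>c\<bar>"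
      using hm by (subst nn_integral_add) (auto simp: emeasure_space_1)
    also have "\<dots> < \<infinity>"
      using neg by (simp add: less_top)
    finally show "(\<integral>\<^sup>+x. ennreal (tail z x) \<partial>\<mu>) < \<infinity>" .
  qed (use tm tail_nonneg in auto)
  then show ?thesis by (rule that)
qed

end

section \<open>Existence of a minimizer\<close>

text \<open>With g = r + v and parts taken by \<open>ennreal\<close>, which sends negative numbers
  to 0, the identity g = r + v is written without subtraction: g+ + v- = g- + r + v+.\<close>

lemma ennreal_split_add:
  assumes "0 \<le> r"
  shows "ennreal (r + v) + ennreal (- v) = ennreal (- (r + v)) + (ennreal r + ennreal v)"
    and "ennreal (- (r + v)) \<le> ennreal (- v)"
proof -
  consider "0 \<le> r + v" "0 \<le> v" | "0 \<le> r + v" "v < 0" | "r + v < 0" "v < 0"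
    using assms by linarith
  then show "ennreal (r + v) + ennreal (- v) = ennreal (- (r + v)) + (ennreal r + ennreal v)"
  proof cases
    case 2
    then have "ennreal (r + v) + ennreal (- v) = ennreal r"
      by (subst ennreal_plus[symmetric]) auto
    with 2 show ?thesis by (simp add: ennreal_neg)
  next
    case 3
    then have "ennreal (- (r + v)) + ennreal r = ennreal (- v)"
      using assms by (subst ennreal_plus[symmetric]) auto
    with 3 show ?thesis by (simp add: ennreal_neg)
  qed (use assms in \<open>simp add: ennreal_neg\<close>)
qed (use assms in \<open>simp add: ennreal_leI\<close>)

text \<open>As \<open>u\<close> is nonnegative, the negative part of the sum is at most that of
  \<open>v\<close>, hence has finite integral. The difference defining \<open>ext_integral\<close>
  is therefore meaningful, also when \<open>u\<close> has infinite integral.\<close>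

lemma ext_integral_add:
  fixes u :: "'b \<Rightarrow> ennreal" and v :: "'b \<Rightarrow> real"
  assumes u: "u \<in> borel_measurable M" and v: "integrable M v"
    and g: "AE x in M. g x = enn2ereal (u x) + ereal (v x)"
  shows "ext_integral M g = enn2ereal (\<integral>\<^sup>+x. u x \<partial>M) + ereal (\<integral>x. v x \<partial>M)"
proof -
  note [measurable] = u borel_measurable_integrable[OF v]
  let ?g = "\<lambda>x. enn2ereal (u x) + ereal (v x)"
  define A where "A = (\<integral>\<^sup>+x. e2ennreal (?g x) \<partial>M)"
  define B where "B = (\<integral>\<^sup>+x. e2ennreal (- ?g x) \<partial>M)"
  define V where "V = (\<integral>\<^sup>+x. ennreal (v x) \<partial>M)"
  define W where "W = (\<integral>\<^sup>+x. ennreal (- v x) \<partial>M)"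
  define a where "a = (\<integral>\<^sup>+x. u x \<partial>M)"
  have ext: "ext_integral M g = enn2ereal A - enn2ereal B"
  proof -
    have "(\<integral>\<^sup>+x. e2ennreal (g x) \<partial>M) = A" "(\<integral>\<^sup>+x. e2ennreal (- g x) \<partial>M) = B"
      unfolding A_def B_def using g by (auto intro!: nn_integral_cong_AE)
    then show ?thesis by (simp add: ext_integral_def)
  qed
  have split: "e2ennreal (?g x) + ennreal (- v x) = e2ennreal (- ?g x) + (u x + ennreal (v x))"
    and le: "e2ennreal (- ?g x) \<le> ennreal (- v x)" for x
  proof -
    have "e2ennreal (?g x) + ennreal (- v x) = e2ennreal (- ?g x) + (u x + ennreal (v x)) \<and>
        e2ennreal (- ?g x) \<le> ennreal (- v x)"
    proof (cases "u x")
      case (real r)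
      have e: "?g x = ereal (r + v x)"
        using real by simp
      show ?thesis
        unfolding e using ennreal_split_add[of r "v x"] real by simp
    qed (simp add: e2ennreal_neg)
    then show "e2ennreal (?g x) + ennreal (- v x) = e2ennreal (- ?g x) + (u x + ennreal (v x))"
      "e2ennreal (- ?g x) \<le> ennreal (- v x)" by auto
  qed
  have "A + W = (\<integral>\<^sup>+x. e2ennreal (?g x) + ennreal (- v x) \<partial>M)"
    unfolding A_def W_def by (rule nn_integral_add[symmetric]) measurable
  also have "\<dots> = (\<integral>\<^sup>+x. e2ennreal (- ?g x) + (u x + ennreal (v x)) \<partial>M)"
    by (simp only: split)
  also have "\<dots> = B + (\<integral>\<^sup>+x. u x + ennreal (v x) \<partial>M)"
    unfolding B_def by (rule nn_integral_add) measurable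
  also have "(\<integral>\<^sup>+x. u x + ennreal (v x) \<partial>M) = a + V"
    unfolding a_def V_def by (rule nn_integral_add) measurable
  finally have eq: "A + W = B + (a + V)" .
  have "B \<le> W"
    unfolding B_def W_def by (intro nn_integral_mono le)
  moreover have VW: "V < \<infinity>" "W < \<infinity>"
    using v unfolding V_def W_def by (auto simp: real_integrable_def less_top)
  ultimately have "B < \<infinity>"
    using le_less_trans by blast
  have I: "(\<integral>x. v x \<partial>M) = enn2real V - enn2real W"
    unfolding V_def W_def by (rule real_lebesgue_integral_def[OF v])
  obtain b V' W' where r: "B = ennreal b" "0 \<le> b" "V = ennreal V'" "0 \<le> V'" "W = ennreal W'" "0 \<le> W'"
    using VW \<open>B < \<infinity>\<close> by (cases B; cases V; cases W) auto
  show ?thesis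
  proof (cases a)
    case (real c)
    then have "A + ennreal W' = ennreal (b + (c + V'))"
      using eq r by simp
    then obtain d where d: "A = ennreal d" "0 \<le> d"
      by (cases A) auto
    with \<open>A + ennreal W' = _\<close> r real have "d + W' = b + (c + V')"
      by (simp flip: ennreal_plus)
    then show ?thesis
      unfolding ext I a_def[symmetric] using d r real by (simp add: enn2ereal_ennreal)
  next
    case top
    then have "A = top"
      using eq r by (cases A) (auto simp flip: ennreal_plus)
    then show ?thesis
      unfolding ext I a_def[symmetric] using r top by (simp add: enn2ereal_ennreal)
  qed
qed

section \<open>The product coupling and the entropy of couplings\<close>

lemma prod_N_density:
  fixes m :: "'a::polish_space measure" and \<rho> :: "'a \<Rightarrow> real"
  assumes m: "sets m = sets borel" "sigma_finite_measure m"
    and \<rho>: "\<rho> \<in> borel_measurable borel" "\<And>x. 0 \<le> \<rho> x"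
    and "prob_space (density m \<rho>)"
  shows "prod_N N (density m \<rho>) = density (prod_N N m) (\<lambda>x. ennreal (\<Prod>i<N. \<rho> (x i)))"
proof -
  interpret m: sigma_finite_measure m by fact
  interpret \<mu>: prob_space "density m \<rho>" by fact
  interpret pm: product_sigma_finite "\<lambda>_::nat. m" ..
  interpret p\<mu>: product_sigma_finite "\<lambda>_::nat. density m \<rho>" ..
  have [measurable_cong]: "sets m = sets borel" by fact
  note [measurable] = \<rho>(1)
  have "density (prod_N N m) (\<lambda>x. ennreal (\<Prod>i<N. \<rho> (x i))) = prod_N N (density m \<rho>)"
  proof (rule p\<mu>.PiM_eqI)
    show "sets (density (prod_N N m) (\<lambda>x. ennreal (\<Prod>i<N. \<rho> (x i)))) = sets (prod_N N (density m \<rho>))"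
      by (simp cong: sets_PiM_cong)
    fix A assume A: "\<And>i. i \<in> {..<N} \<Longrightarrow> A i \<in> sets (density m \<rho>)"
    then have A'[measurable]: "A i \<in> sets m" if "i < N" for i
      using that by simp
    have "emeasure (density (prod_N N m) (\<lambda>x. ennreal (\<Prod>i<N. \<rho> (x i)))) (Pi\<^sub>E {..<N} A) =
        (\<integral>\<^sup>+x. ennreal (\<Prod>i<N. \<rho> (x i)) * indicator (Pi\<^sub>E {..<N} A) x \<partial>prod_N N m)"
      by (rule emeasure_density) (auto intro!: sets_PiM_I_finite A')
    also have "\<dots> = (\<integral>\<^sup>+x. (\<Prod>i<N. ennreal (\<rho> (x i)) * indicator (A i) (x i)) \<partial>prod_N N m)"
    proof (rule nn_integral_cong)
      fix x assume "x \<in> space (prod_N N m)"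
      then have "indicator (Pi\<^sub>E {..<N} A) x = (\<Prod>i<N. indicator (A i) (x i) :: ennreal)"
        by (auto simp: space_PiM PiE_iff indicator_def)
      then show "ennreal (\<Prod>i<N. \<rho> (x i)) * indicator (Pi\<^sub>E {..<N} A) x =
          (\<Prod>i<N. ennreal (\<rho> (x i)) * indicator (A i) (x i))"
        using \<rho>(2) by (simp add: prod.distrib prod_ennreal)
    qed
    also have "\<dots> = (\<Prod>i<N. \<integral>\<^sup>+x. ennreal (\<rho> x) * indicator (A i) x \<partial>m)"
      by (rule pm.product_nn_integral_prod) auto
    also have "\<dots> = (\<Prod>i<N. emeasure (density m \<rho>) (A i))"
      by (intro prod.cong refl emeasure_density[symmetric]) auto
    finally show "emeasure (density (prod_N N m) (\<lambda>x. ennreal (\<Prod>i<N. \<rho> (x i)))) (Pi\<^sub>E {..<N} A) =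
        (\<Prod>i<N. emeasure (density m \<rho>) (A i))" .
  qed simp
  then show ?thesis ..
qed

lemma prod_N_in_Pi_sym:
  fixes \<mu> :: "'a::polish_space measure"
  assumes \<mu>: "prob_space \<mu>" "sets \<mu> = sets borel"
  shows "prod_N N \<mu> \<in> Pi_sym N \<mu>"
  unfolding Pi_sym_def
proof (intro CollectI conjI allI impI)
  show s: "sets (prod_N N \<mu>) = sets (borel_N N)"
    using \<mu>(2) by (intro sets_PiM_cong) auto
  show "prob_space (prod_N N \<mu>)"
    using \<mu>(1) by (rule prob_space_PiM)
  fix \<pi> assume "\<pi> permutes {..<N}"
  then have "distr (prod_N N \<mu>) (prod_N N \<mu>) (\<lambda>x. \<lambda>i\<in>{..<N}. x (\<pi> i)) = prod_N N \<mu>"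
    using distr_PiM_reindex[of "{..<N}" "\<lambda>_. \<mu>" \<pi> "{..<N}"] \<mu>(1)
      permutes_in_image[of \<pi> "{..<N}"] permutes_inj_on[of \<pi> "{..<N}"] by auto
  then show "distr (prod_N N \<mu>) (borel_N N) (\<lambda>x. \<lambda>i\<in>{..<N}. x (\<pi> i)) = prod_N N \<mu>"
    using distr_cong[OF refl s refl] by metis
next
  fix i assume "i < N"
  then have "distr (prod_N N \<mu>) \<mu> (\<lambda>x. x i) = \<mu>"
    using \<mu>(1) by (intro distr_PiM_component) auto
  then show "distr (prod_N N \<mu>) borel (\<lambda>x. x i) = \<mu>"
    using distr_cong[OF refl \<mu>(2) refl] by metis
qed

lemma Pi_sym_marginal:
  assumes \<gamma>: "\<gamma> \<in> Pi_sym N \<mu>" and i: "i < N"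
    and g: "g \<in> borel_measurable borel" "integrable \<mu> g"
  shows "integrable \<gamma> (\<lambda>x. g (x i) :: real)" "(\<integral>x. g (x i) \<partial>\<gamma>) = (\<integral>x. g x \<partial>\<mu>)"
proof -
  note D = Pi_symD[OF \<gamma>]
  note c = component_measurable[OF D(1) i]
  show "integrable \<gamma> (\<lambda>x. g (x i))"
    using integrable_distr_eq[OF c g(1)] g(2) D(5)[OF i] by simp
  show "(\<integral>x. g (x i) \<partial>\<gamma>) = (\<integral>x. g x \<partial>\<mu>)"
    using integral_distr[OF c g(1)] D(5)[OF i] by simp
qed

text \<open>The part of \<open>\<gamma>\<close> living where \<open>\<Prod>i. \<rho> (x i)\<close> vanishes is negligible because of the marginals, so
  \<open>\<gamma>\<close> may be compared with the product of its marginals instead of the reference measure.\<close>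

lemma Pi_sym_absolutely_continuous_iff:
  fixes m :: "'a::polish_space measure" and \<rho> :: "'a \<Rightarrow> real"
  assumes m: "sets m = sets borel" "sigma_finite_measure m"
    and \<rho>: "\<rho> \<in> borel_measurable borel" "\<And>x. 0 \<le> \<rho> x"
    and \<mu>: "prob_space (density m \<rho>)" and \<gamma>: "\<gamma> \<in> Pi_sym N (density m \<rho>)"
  shows "absolutely_continuous (prod_N N m) \<gamma> \<longleftrightarrow> absolutely_continuous (prod_N N (density m \<rho>)) \<gamma>"
proof -
  note D = Pi_symD[OF \<gamma>]
  define R where "R x = (\<Prod>i<N. \<rho> (x i))" for x
  have [measurable_cong]: "sets m = sets borel" by fact
  note [measurable] = \<rho>(1)
  have R: "R \<in> borel_measurable (prod_N N m)"
    unfolding R_def[abs_def] by measurable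
  have R0: "0 \<le> R x" for x
    unfolding R_def using \<rho>(2) by (intro prod_nonneg) auto
  have P: "prod_N N (density m \<rho>) = density (prod_N N m) (\<lambda>x. ennreal (R x))"
    unfolding R_def by (rule prod_N_density[OF m \<rho> \<mu>])
  have sm: "sets (prod_N N m) = sets (borel_N N)"
    using m(1) by (intro sets_PiM_cong) auto
  show ?thesis
  proof
    assume ac: "absolutely_continuous (prod_N N m) \<gamma>"
    have pos: "AE x in \<gamma>. R x \<noteq> 0"
    proof -
      have "AE x in \<gamma>. \<rho> (x i) \<noteq> 0" if i: "i < N" for i
      proof -
        have "AE x in density m \<rho>. \<rho> x \<noteq> 0"
          by (subst AE_density) auto
        then have "AE x in distr \<gamma> borel (\<lambda>x. x i). \<rho> x \<noteq> 0"
          unfolding D(5)[OF i] .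
        then show ?thesis
          by (rule AE_distrD[OF component_measurable[OF D(1) i]])
      qed
      then have "AE x in \<gamma>. \<forall>i\<in>{..<N}. \<rho> (x i) \<noteq> 0"
        by (intro AE_finite_allI) auto
      then show ?thesis
        by eventually_elim (auto simp: R_def)
    qed
    show "absolutely_continuous (prod_N N (density m \<rho>)) \<gamma>"
      unfolding absolutely_continuous_def
    proof
      fix A assume A: "A \<in> null_sets (prod_N N (density m \<rho>))"
      then have As: "A \<in> sets (prod_N N m)"
        unfolding P by auto
      have "AE x in prod_N N m. x \<in> A \<longrightarrow> ennreal (R x) = 0"
        using A R unfolding P by (subst (asm) null_sets_density_iff) auto
      then have "AE x in \<gamma>. x \<in> A \<longrightarrow> ennreal (R x) = 0"
        by (intro absolutely_continuous_AE[OF _ ac]) (simp_all add: sm D(1))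
      with pos have "AE x in \<gamma>. x \<notin> A"
        by eventually_elim (use R0 in \<open>auto simp: ennreal_eq_0_iff order_antisym\<close>)
      then show "A \<in> null_sets \<gamma>"
        using As by (subst AE_iff_null_sets) (auto simp: sm D(1))
    qed
  next
    assume "absolutely_continuous (prod_N N (density m \<rho>)) \<gamma>"
    moreover have "absolutely_continuous (prod_N N m) (prod_N N (density m \<rho>))"
      unfolding P using R by (intro absolutely_continuousI_density) simp
    ultimately show "absolutely_continuous (prod_N N m) \<gamma>"
      unfolding absolutely_continuous_def by blast
  qed
qed

text \<open>If \<open>h\<close> is the density of \<gamma> relative to the product of the marginals,
  whose own density is \<open>R\<close>, then ln (R h) = ln h + ln R where both are positive. There
  ln R is a sum of functions of single coordinates, so its integral against \<gamma> is fixed by the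
  marginals.\<close>

lemma Ent_eq_rel_ent:
  fixes m :: "'a::polish_space measure" and \<rho> :: "'a \<Rightarrow> real"
  assumes m: "sets m = sets borel" "sigma_finite_measure m"
    and \<rho>: "\<rho> \<in> borel_measurable borel" "\<And>x. 0 \<le> \<rho> x"
    and \<mu>: "prob_space (density m \<rho>)" and int: "integrable m (\<lambda>x. \<rho> x * ln (\<rho> x))"
    and \<gamma>: "\<gamma> \<in> Pi_sym N (density m \<rho>)"
  shows "Ent N m \<gamma> = enn2ereal (rel_ent (prod_N N (density m \<rho>)) \<gamma>) +
      ereal (real N * (\<integral>x. \<rho> x * ln (\<rho> x) \<partial>m))"
proof (cases "absolutely_continuous (prod_N N m) \<gamma>")
  case False
  then show ?thesis
    using Pi_sym_absolutely_continuous_iff[OF m \<rho> \<mu> \<gamma>] by (simp add: Ent_def rel_ent_def)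
next
  case True
  note D = Pi_symD[OF \<gamma>]
  let ?P = "prod_N N (density m \<rho>)" and ?M = "prod_N N m"
  interpret m: sigma_finite_measure m by fact
  interpret \<mu>: prob_space "density m \<rho>" by fact
  interpret \<gamma>: prob_space \<gamma> by (rule D(2))
  interpret pm: product_sigma_finite "\<lambda>_::nat. m" ..
  interpret M: sigma_finite_measure ?M by (rule pm.sigma_finite) simp
  interpret P: prob_space ?P by (intro prob_space_PiM \<mu>)
  have [measurable_cong]: "sets m = sets borel" by fact
  note [measurable] = \<rho>(1)
  define R where "R x = (\<Prod>i<N. \<rho> (x i))" for x
  have R[measurable]: "R \<in> borel_measurable ?M"
    unfolding R_def[abs_def] by measurable
  have R0: "0 \<le> R x" for x
    unfolding R_def using \<rho>(2) by (intro prod_nonneg) auto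
  have P: "?P = density ?M (\<lambda>x. ennreal (R x))"
    unfolding R_def by (rule prod_N_density[OF m \<rho> \<mu>])
  have sm: "sets ?M = sets (borel_N N)"
    using m(1) by (intro sets_PiM_cong) auto
  have sP: "sets ?P = sets ?M"
    unfolding P by simp
  have ac: "absolutely_continuous ?P \<gamma>"
    using True Pi_sym_absolutely_continuous_iff[OF m \<rho> \<mu> \<gamma>] by simp
  have s\<gamma>: "sets \<gamma> = sets ?P"
    by (simp add: sP sm D(1))
  obtain h :: "(nat \<Rightarrow> 'a) \<Rightarrow> real" where hP: "h \<in> borel_measurable ?P" and h0: "\<And>x. 0 \<le> h x"
    and \<gamma>h: "\<gamma> = density ?P (\<lambda>x. ennreal (h x))"
    using real_density_exists[OF P.sigma_finite_measure_axioms D(2) s\<gamma> ac] by metis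
  have h[measurable]: "h \<in> borel_measurable ?M"
    using hP measurable_cong_sets[OF sP refl] by blast
  have \<gamma>M: "\<gamma> = density ?M (\<lambda>x. ennreal (R x * h x))"
    unfolding \<gamma>h P using R0 h0 by (subst density_density_eq) (auto simp: ennreal_mult)
  define l where "l x = (\<Sum>i<N. ln (\<rho> (x i)))" for x
  have l[measurable]: "l \<in> borel_measurable ?M"
    unfolding l_def[abs_def] by measurable
  have "AE x in ?M. ennreal (R x * h x) = RN_deriv ?M \<gamma> x"
    by (rule M.RN_deriv_unique[OF _ \<gamma>M[symmetric]]) measurable
  \<comment> \<open>The term R h - R undoes the affine part of \<open>ent_fn\<close>; it integrates
    to 1 - 1 = 0.\<close>
  then have g: "AE x in ?M. (let r = enn2real (RN_deriv ?M \<gamma> x) in ereal (r * ln r)) =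
      enn2ereal (ennreal (R x) * ennreal (ent_fn (h x))) + ereal (R x * h x - R x + R x * h x * l x)"
  proof eventually_elim
    case (elim x)
    have r: "enn2real (RN_deriv ?M \<gamma> x) = R x * h x"
      using R0 h0 by (simp flip: elim)
    have "R x * h x * ln (R x * h x) = R x * ent_fn (h x) + (R x * h x - R x + R x * h x * l x)"
    proof (cases "R x = 0 \<or> h x = 0")
      case False
      then have pos: "0 < R x" "0 < h x"
        using R0[of x] h0[of x] by (auto simp: less_le)
      then have "\<rho> (x i) \<noteq> 0" if "i < N" for i
        using that pos(1) unfolding R_def
        by (metis finite_lessThan lessThan_iff order_less_irrefl prod_zero_iff)
      then have "ln (R x) = l x"
        unfolding R_def l_def using \<rho>(2) by (intro ln_prod) (auto simp: less_le)
      then show ?thesis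
        using pos by (simp add: ln_mult ent_fn_def algebra_simps)
    qed (auto simp: ent_fn_def)
    then show ?case
      using R0[of x] ent_fn_nonneg[OF h0, of x]
      by (simp add: r Let_def enn2ereal_ennreal flip: ennreal_mult)
  qed
  have intl: "integrable \<gamma> (\<lambda>x. ln (\<rho> (x i)))" "(\<integral>x. ln (\<rho> (x i)) \<partial>\<gamma>) = (\<integral>x. \<rho> x * ln (\<rho> x) \<partial>m)"
    if i: "i < N" for i
  proof -
    have "integrable (density m \<rho>) (\<lambda>x. ln (\<rho> x))"
      using int \<rho>(2) by (subst integrable_density) auto
    moreover have "(\<integral>x. ln (\<rho> x) \<partial>density m \<rho>) = (\<integral>x. \<rho> x * ln (\<rho> x) \<partial>m)"
      using \<rho>(2) by (subst integral_density) auto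
    ultimately show "integrable \<gamma> (\<lambda>x. ln (\<rho> (x i)))"
      "(\<integral>x. ln (\<rho> (x i)) \<partial>\<gamma>) = (\<integral>x. \<rho> x * ln (\<rho> x) \<partial>m)"
      using Pi_sym_marginal[OF \<gamma> i, of "\<lambda>x. ln (\<rho> x)"] by auto
  qed
  have l_int: "integrable \<gamma> l" "(\<integral>x. l x \<partial>\<gamma>) = real N * (\<integral>x. \<rho> x * ln (\<rho> x) \<partial>m)"
    unfolding l_def[abs_def] using intl by (auto simp: Bochner_Integration.integral_sum)
  have mass: "integrable ?M u \<and> (\<integral>x. u x \<partial>?M) = 1"
    if Q: "prob_space Q" "Q = density ?M (\<lambda>x. ennreal (u x))" and u[measurable]: "u \<in> borel_measurable ?M"
      and u0: "\<And>x. 0 \<le> u x" for u Q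
  proof -
    have "(\<integral>\<^sup>+x. ennreal (u x) \<partial>?M) = 1"
      using prob_space.emeasure_space_1[OF Q(1)] unfolding Q(2)
      by (simp add: emeasure_density cong: nn_integral_cong)
    then show ?thesis
      using u0 by (intro conjI integrableI_nonneg) (auto simp: integral_eq_nn_integral)
  qed
  have Rh: "integrable ?M (\<lambda>x. R x * h x)" "(\<integral>x. R x * h x \<partial>?M) = 1"
    using mass[OF D(2) \<gamma>M] R0 h0 by auto
  have R1: "integrable ?M R" "(\<integral>x. R x \<partial>?M) = 1"
    using mass[OF P.prob_space_axioms P] R0 by auto
  have Rhl: "integrable ?M (\<lambda>x. R x * h x * l x)"
    "(\<integral>x. R x * h x * l x \<partial>?M) = real N * (\<integral>x. \<rho> x * ln (\<rho> x) \<partial>m)"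
    using l_int R0 h0 unfolding \<gamma>M by (simp_all add: integrable_density integral_density)
  have "Ent N m \<gamma> = enn2ereal (\<integral>\<^sup>+x. ennreal (R x) * ennreal (ent_fn (h x)) \<partial>?M) +
      ereal (\<integral>x. R x * h x - R x + R x * h x * l x \<partial>?M)"
    unfolding Ent_def using True Rh R1 Rhl
    by (simp only: if_True) (intro ext_integral_add[OF _ _ g]; simp)
  also have "(\<integral>\<^sup>+x. ennreal (R x) * ennreal (ent_fn (h x)) \<partial>?M) = rel_ent ?P \<gamma>"
    unfolding \<gamma>h rel_ent_density[OF P.sigma_finite_measure_axioms hP h0]
    unfolding P by (subst nn_integral_density) auto
  also have "(\<integral>x. R x * h x - R x + R x * h x * l x \<partial>?M) = real N * (\<integral>x. \<rho> x * ln (\<rho> x) \<partial>m)"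
    using Rh R1 Rhl by simp
  finally show ?thesis .
qed

context repulsive
begin

text \<open>The subtracted tails see one coordinate at a time, so their total is the same for all
  couplings: \<open>C0\<close> and the nonnegative shifted cost differ by a constant.\<close>

lemma C0_eq:
  fixes \<mu> :: "'a::polish_space measure"
  assumes \<gamma>: "\<gamma> \<in> Pi_sym N \<mu>" and tail: "integrable \<mu> (tail z)"
  shows "C0 N f \<gamma> = enn2ereal (\<integral>\<^sup>+x. shifted_cost N z x \<partial>\<gamma>) +
      ereal (- (\<Sum>i<N. \<Sum>j\<in>{i<..<N}. 2 * (\<integral>x. tail z x \<partial>\<mu>)))"
proof -
  note D = Pi_symD[OF \<gamma>]
  note T = Pi_sym_marginal[OF \<gamma> _ tail_measurable tail]
  have I: "integrable \<gamma> (\<lambda>x. tail z (x i) + tail z (x j))"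
    "(\<integral>x. tail z (x i) + tail z (x j) \<partial>\<gamma>) = 2 * (\<integral>x. tail z x \<partial>\<mu>)" if "i < N" "j < N" for i j
    using T[OF that(1)] T[OF that(2)] by simp_all
  have "(\<integral>x. tail_sum N z x \<partial>\<gamma>) =
      (\<Sum>i<N. \<integral>x. (\<Sum>j\<in>{i<..<N}. tail z (x i) + tail z (x j)) \<partial>\<gamma>)"
    unfolding tail_sum_def using I(1)
    by (intro Bochner_Integration.integral_sum Bochner_Integration.integrable_sum) auto
  also have "\<dots> = (\<Sum>i<N. \<Sum>j\<in>{i<..<N}. \<integral>x. tail z (x i) + tail z (x j) \<partial>\<gamma>)"
    using I(1) by (intro sum.cong refl Bochner_Integration.integral_sum) auto
  also have "\<dots> = (\<Sum>i<N. \<Sum>j\<in>{i<..<N}. 2 * (\<integral>x. tail z x \<partial>\<mu>))"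
    using I(2) by (intro sum.cong refl) auto
  finally have eq: "(\<integral>x. tail_sum N z x \<partial>\<gamma>) = (\<Sum>i<N. \<Sum>j\<in>{i<..<N}. 2 * (\<integral>x. tail z x \<partial>\<mu>))" .
  have "integrable \<gamma> (tail_sum N z)"
    unfolding tail_sum_def[abs_def] using I(1)
    by (intro Bochner_Integration.integrable_sum) auto
  then have "C0 N f \<gamma> = enn2ereal (\<integral>\<^sup>+x. shifted_cost N z x \<partial>\<gamma>) +
      ereal (\<integral>x. - tail_sum N z x \<partial>\<gamma>)"
    unfolding C0_def
    by (intro ext_integral_add shifted_cost_measurable[OF D(1)] Bochner_Integration.integrable_minus
        AE_I2 cost_eq)
  then show ?thesis
    by (simp only: Bochner_Integration.integral_minus eq)
qed

end

section \<open>Minimizing the nonnegative functional\<close>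

lemma liminf_add_le_ennreal:
  fixes u v :: "nat \<Rightarrow> ennreal"
  shows "liminf u + liminf v \<le> liminf (\<lambda>n. u n + v n)"
  using sum_liminf_le[of "{True, False}" "\<lambda>b. if b then u else v"] by simp

locale entropic_transport = repulsive +
  fixes N :: nat and \<mu> :: "'a::polish_space measure" and z :: 'a and \<epsilon> :: real
  assumes prob: "prob_space \<mu>" and sets_mu: "sets \<mu> = sets borel" and eps: "0 \<le> \<epsilon>"
begin

text \<open>In \<open>ennreal\<close> 0 times \<infinity> is 0, so at \<epsilon> = 0 the formula
  reduces to the shifted cost even for couplings of infinite entropy.\<close>

definition J :: "(nat \<Rightarrow> 'a) measure \<Rightarrow> ennreal" where
  "J \<gamma> = (\<integral>\<^sup>+x. shifted_cost N z x \<partial>\<gamma>) + ennreal \<epsilon> * rel_ent (prod_N N \<mu>) \<gamma>"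

lemma J_lsc:
  assumes U: "base_sequence U" and conv: "base_sequence.box_conv U N G \<gamma>"
    and G: "\<And>n. G n \<in> Pi_sym N \<mu>" and \<gamma>: "\<gamma> \<in> Pi_sym N \<mu>"
    and C: "\<And>n. J (G n) \<le> ennreal C" "0 \<le> C"
  shows "J \<gamma> \<le> liminf (\<lambda>n. J (G n))"
proof -
  interpret base_sequence U by fact
  note GD = Pi_symD[OF G] and D = Pi_symD[OF \<gamma>]
  let ?P = "prod_N N \<mu>"
  note P = Pi_symD[OF prod_N_in_Pi_sym[OF prob sets_mu, of N]]
  have c: "(\<integral>\<^sup>+x. shifted_cost N z x \<partial>\<gamma>) \<le> liminf (\<lambda>n. \<integral>\<^sup>+x. shifted_cost N z x \<partial>G n)"
    by (rule shifted_cost_lsc[OF U conv GD(2,1) D(2,1)])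
  have e: "ennreal \<epsilon> * rel_ent ?P \<gamma> \<le> liminf (\<lambda>n. ennreal \<epsilon> * rel_ent ?P (G n))"
  proof (cases "\<epsilon> = 0")
    case False
    with eps have \<epsilon>: "0 < \<epsilon>" by simp
    \<comment> \<open>Both terms of \<open>J\<close> are nonnegative, so its bound controls the
      entropies after division by \<epsilon>; this uniform bound is what \<open>rel_ent_lsc\<close>
      requires.\<close>
    have bound: "rel_ent ?P (G n) \<le> ennreal (C / \<epsilon>)" for n
    proof -
      have "ennreal \<epsilon> * rel_ent ?P (G n) \<le> ennreal C"
        using C(1)[of n] unfolding J_def by (rule order_trans[rotated]) simp
      also have "\<dots> = ennreal \<epsilon> * ennreal (C / \<epsilon>)"
        using \<epsilon> C(2) by (subst ennreal_mult[symmetric]) auto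
      finally show ?thesis
        using \<epsilon> by (subst (asm) ennreal_mult_le_mult_iff) auto
    qed
    have "rel_ent ?P \<gamma> \<le> liminf (\<lambda>n. rel_ent ?P (G n))"
    proof (rule rel_ent_lsc[OF P(2) GD(2) _ D(2) _ bound])
      let ?E = "box N ` {J. finite J}"
      show "Int_stable ?E" by (rule Int_stable_cyl)
      show "?E \<subseteq> Pow (space ?P)" by (auto simp: cyl_def P(3))
      show "sets ?P = sigma_sets (space ?P) ?E"
        using cyl_generates[OF sets_borel_N_eq_sigma_slab, of N] by (simp add: P(1,3))
      show "(\<lambda>n. measure (G n) A) \<longlonglongrightarrow> measure \<gamma> A" if "A \<in> ?E" for A
        using that conv by (auto simp: box_conv_def)
    qed (use P(1) GD(1) D(1) \<epsilon> C(2) in auto)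
    then have "ennreal \<epsilon> * rel_ent ?P \<gamma> \<le> ennreal \<epsilon> * liminf (\<lambda>n. rel_ent ?P (G n))"
      by (rule mult_left_mono) simp
    also have "\<dots> = liminf (\<lambda>n. ennreal \<epsilon> * rel_ent ?P (G n))"
      by (rule Liminf_compose_continuous_mono[symmetric])
        (auto intro!: ennreal_continuous_on_cmult continuous_on_id monoI mult_left_mono)
    finally show ?thesis .
  qed simp
  have "J \<gamma> \<le> liminf (\<lambda>n. \<integral>\<^sup>+x. shifted_cost N z x \<partial>G n) + liminf (\<lambda>n. ennreal \<epsilon> * rel_ent ?P (G n))"
    unfolding J_def by (rule add_mono[OF c e])
  also have "\<dots> \<le> liminf (\<lambda>n. J (G n))"
    unfolding J_def by (rule liminf_add_le_ennreal)
  finally show ?thesis .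
qed

lemma J_minimizer: "\<exists>\<gamma>\<in>Pi_sym N \<mu>. \<forall>\<gamma>'\<in>Pi_sym N \<mu>. J \<gamma> \<le> J \<gamma>'"
proof -
  obtain U :: "nat \<Rightarrow> 'a set" where U: "base_sequence U"
    using base_sequence_exists by blast
  interpret base_sequence U by fact
  define I where "I = (INF \<gamma>\<in>Pi_sym N \<mu>. J \<gamma>)"
  have I_le: "I \<le> J \<gamma>" if "\<gamma> \<in> Pi_sym N \<mu>" for \<gamma>
    unfolding I_def using that by (rule INF_lower)
  show ?thesis
  proof (cases "I = top")
    case True
    \<comment> \<open>When \<open>J\<close> is infinite on all couplings every one of them is a
      minimizer; the product shows that there is one.\<close>
    have "prod_N N \<mu> \<in> Pi_sym N \<mu>"
      by (rule prod_N_in_Pi_sym[OF prob sets_mu])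
    moreover have "J \<gamma> = top" if "\<gamma> \<in> Pi_sym N \<mu>" for \<gamma>
      using I_le[OF that] True by (simp add: top_unique)
    ultimately show ?thesis by force
  next
    case False
    then obtain i where i: "I = ennreal i" "0 \<le> i"
      by (cases I) auto
    have "\<exists>\<gamma>. \<gamma> \<in> Pi_sym N \<mu> \<and> J \<gamma> < ennreal (i + 1 / real (Suc n))" for n
    proof -
      have "I < ennreal (i + 1 / real (Suc n))"
        using i by (simp add: ennreal_less_iff)
      then show ?thesis
        unfolding I_def by (auto simp: INF_less_iff)
    qed
    then obtain G where G: "\<And>n. G n \<in> Pi_sym N \<mu>"
      and JG: "\<And>n. J (G n) < ennreal (i + 1 / real (Suc n))"
      by metis
    obtain r \<gamma> where r: "strict_mono r" and \<gamma>: "\<gamma> \<in> Pi_sym N \<mu>"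
      and conv: "box_conv N (\<lambda>n. G (r n)) \<gamma>"
      by (rule Pi_sym_sequentially_compact[OF prob sets_mu G])
    have bound: "J (G n) \<le> ennreal (i + 1)" for n
      using JG[of n] by (rule order.strict_implies_order[OF less_le_trans]) (intro ennreal_leI, simp)
    have "J \<gamma> \<le> liminf (\<lambda>n. J (G (r n)))"
      by (rule J_lsc[OF U conv G \<gamma> bound]) (use i(2) in simp)
    also have "\<dots> \<le> liminf (\<lambda>n. ennreal (i + 1 / real (Suc (r n))))"
      using JG by (intro Liminf_mono always_eventually allI less_imp_le)
    also have "\<dots> = I"
    proof (rule lim_imp_Liminf)
      have "(\<lambda>n. i + 1 / real (Suc n)) \<longlonglongrightarrow> i + 0"
        by (intro tendsto_add tendsto_const) (use LIMSEQ_inverse_real_of_nat in \<open>simp add: inverse_eq_divide\<close>)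
      then have "(\<lambda>n. ennreal (i + 1 / real (Suc n))) \<longlonglongrightarrow> I"
        unfolding i(1) by (intro tendsto_ennrealI) simp
      from LIMSEQ_subseq_LIMSEQ[OF this r]
      show "(\<lambda>n. ennreal (i + 1 / real (Suc (r n)))) \<longlonglongrightarrow> I"
        by (simp add: o_def)
    qed simp
    finally show ?thesis
      using \<gamma> I_le order_trans by blast
  qed
qed

end

theorem proposition2p5:
  fixes N :: nat
    and m :: "'a::polish_space measure"
    and \<rho> :: "'a \<Rightarrow> real"
    and f :: "real \<Rightarrow> ereal"
    and \<epsilon> :: real
  assumes "N \<ge> 2"
    and "sets m = sets borel" and "sigma_finite_measure m"
    and "\<rho> \<in> borel_measurable borel" and "\<And>x. 0 \<le> \<rho> x"
    and "density m \<rho> \<in> Pac m"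
    and "integrable m (\<lambda>x. \<rho> x * ln (\<rho> x))"
    and "cond_A N (density m \<rho>)"
    and "cond_B f (density m \<rho>)"
    and "f 0 = \<infinity>" and "cond_F1 f" and "cond_F2 f"
    and "0 \<le> \<epsilon>"
  shows "\<exists>\<gamma>. is_arg_min (C_eps N m f \<epsilon>) (\<lambda>\<gamma>. \<gamma> \<in> Pi_sym N (density m \<rho>)) \<gamma>"
proof -
  let ?\<mu> = "density m \<rho>"
  have \<mu>: "prob_space ?\<mu>" "sets ?\<mu> = sets borel"
    using assms(6) by (auto simp: Pac_def)
  interpret repulsive f
    using assms(10-12) by unfold_locales
  obtain z where z: "integrable ?\<mu> (tail z)"
    by (rule tail_integrable[OF \<mu> assms(9)])
  interpret entropic_transport f N ?\<mu> z \<epsilon>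
    by (intro entropic_transport.intro entropic_transport_axioms.intro repulsive_axioms \<mu> assms(13))
  define c where "c = - (\<Sum>i<N. \<Sum>j\<in>{i<..<N}. 2 * (\<integral>x. tail z x \<partial>?\<mu>)) +
      \<epsilon> * (real N * (\<integral>x. \<rho> x * ln (\<rho> x) \<partial>m))"
  have C: "C_eps N m f \<epsilon> \<gamma> = enn2ereal (J \<gamma>) + ereal c" if \<gamma>: "\<gamma> \<in> Pi_sym N ?\<mu>" for \<gamma>
  proof -
    note E = Ent_eq_rel_ent[OF assms(2-5) \<mu>(1) assms(7) \<gamma>]
    \<comment> \<open>Multiplication does not distribute over addition in \<open>ereal\<close>
      without side conditions; here the only infinite values are positive and \<epsilon> > 0, so
      cases suffice.\<close>
    have arith: "(enn2ereal a + ereal s) + ereal \<epsilon> * (enn2ereal b + ereal t) =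
        enn2ereal (a + ennreal \<epsilon> * b) + ereal (s + \<epsilon> * t)" if "0 < \<epsilon>" for a b s t
    proof (cases "a = top \<or> b = top")
      case True
      then show ?thesis
        using that by (cases a; cases b) (auto simp: enn2ereal_ennreal ennreal_mult_top)
    next
      case False
      then obtain a' b' where ab: "a = ennreal a'" "0 \<le> a'" "b = ennreal b'" "0 \<le> b'"
        by (cases a; cases b) auto
      have "a + ennreal \<epsilon> * b = ennreal (a' + \<epsilon> * b')"
        using ab that by (simp add: ennreal_mult)
      moreover have "0 \<le> a' + \<epsilon> * b'"
        using ab that by simp
      ultimately have e: "enn2ereal (a + ennreal \<epsilon> * b) = ereal (a' + \<epsilon> * b')"
        by (simp only: enn2ereal_ennreal)
      show ?thesis
        unfolding e using ab by (simp add: enn2ereal_ennreal algebra_simps)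
    qed
    show ?thesis
    proof (cases "\<epsilon> = 0")
      case True
      then have "J \<gamma> = (\<integral>\<^sup>+x. shifted_cost N z x \<partial>\<gamma>)"
        unfolding J_def by simp
      then show ?thesis
        unfolding C_eps_def C0_eq[OF \<gamma> z] c_def using True by simp
    next
      case False
      then have "0 < \<epsilon>" using assms(13) by simp
      with False show ?thesis
        unfolding C_eps_def C0_eq[OF \<gamma> z] E J_def c_def by (simp only: arith if_False)
    qed
  qed
  obtain \<gamma> where \<gamma>: "\<gamma> \<in> Pi_sym N ?\<mu>" and le: "\<And>\<gamma>'. \<gamma>' \<in> Pi_sym N ?\<mu> \<Longrightarrow> J \<gamma> \<le> J \<gamma>'"
    using J_minimizer by blast
  have "C_eps N m f \<epsilon> \<gamma> \<le> C_eps N m f \<epsilon> \<gamma>'" if "\<gamma>' \<in> Pi_sym N ?\<mu>" for \<gamma>'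
    unfolding C[OF \<gamma>] C[OF that] using le[OF that]
    by (intro add_right_mono) (simp add: less_eq_ennreal.rep_eq)
  then show ?thesis
    using \<gamma> by (auto simp: is_arg_min_def not_less)
qed

end
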